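(* Let $\mathcal M$ be a convex set of compactly supported distributions on $\mathbb R$ for which there exist three distinct points $x,y,z\in\mathbb R$ with $\delta_x,\delta_y,\delta_z\in\mathcal M$. Let $h\in\mathcal H^{\rm BV}$. The following statements are equivalent. (i) $h\in\mathcal H^{\rm CX}\cup\mathcal H^{\rm QSM}$. (ii) $I_h$ is p-quasi-convex on $\mathcal M$. (iii) $R_{h,v}$ is p-quasi-convex on $\mathcal M$ for some $v\in\mathcal V_{\mathcal M}$ (such that $R_{h,v}$ is real-valued on $\mathcal M$). (iv) $R_{h,v}$ is p-quasi-convex on $\mathcal M$ for all measurable functions $v:\mathbb R\to\mathbb R$ (such that $R_{h,v}$ is real-valued on $\mathcal M$).
   Context: A distribution is a Borel probability measure on $\mathbb R$; write $F(x)=F((-\infty,x])$. $\delta_x$ is the point mass at $x$; $\mathcal M_c$ is the set of compactly supported distributions. $\mathcal H^{\rm BV}$ is the set of functions $h:[0,1]\to\mathbb R$ of bounded variation with $h(0)=0$. For $h\in\mathcal H^{\rm BV}$, $I_h(F)=\int_0^\infty h(F((x,\infty)))\,dx+\int_{-\infty}^0\big(h(F((x,\infty)))-h(1)\big)\,dx$. For measurable $v:\mathbb R\to\mathbb R$, $R_{h,v}(F)=I_h(F\circ v^{-1})$, where $F\circ v^{-1}$ is the push-forward of $F$ under $v$. $R_{h,v}$ being real-valued on $\mathcal M$ means that both integrals defining $I_h(F\circ v^{-1})$ are finite for all $F\in\mathcal M$. $\mathcal V_{\mathcal M}$ is the set of measurable $v:\mathbb R\to\mathbb R$ such that $v(x),v(y),v(z)$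 are distinct for some $x,y,z$ with $\delta_x,\delta_y,\delta_z\in\mathcal M$. A functional $\rho:\mathcal M\to\mathbb R$ is p-quasi-convex if $\rho(\lambda F+(1-\lambda)G)\le\max\{\rho(F),\rho(G)\}$ for all $F,G\in\mathcal M$, $\lambda\in[0,1]$. Quantiles: for $\alpha\in(0,1)$, $Q_\alpha^-(F)=\inf\{x:F(x)\ge\alpha\}$, $Q_\alpha^+(F)=\inf\{x:F(x)>\alpha\}$; $Q_0^\pm(F)=Q_0(F)=\inf\{x:F(x)>0\}$; $Q_1^\pm(F)=Q_1(F)=\inf\{x:F(x)\ge1\}$. For $c,\alpha\in[0,1]$, $Q_\alpha^c=cQ_\alpha^++(1-c)Q_\alpha^-$. For $a,b\ge0$, $S_{a,b}=aQ_0-bQ_1$. $\mathcal H^{\rm CX}$ is the set of $h\in\mathcal H^{\rm BV}$ that are convex on $[0,1]$. $\mathcal H^{\rm QSM}$ is the set of $h\in\mathcal H^{\rm BV}$ for which there exist $a,b\ge0$, $\alpha,c\in[0,1]$, $k\in\mathbb R$ with $I_h=S_{a,b}+kQ_\alpha^c$ on $\mathcal M_c$ (distortion functions of scaled quantile-spread mixtures). *)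

theory Defs
  imports "HOL-Probability.Probability"
begin

text \<open>A distribution is a Borel probability measure on the reals, i.e. an instance of the
  library locale \<^locale>\<open>real_distribution\<close>.  The point mass at \<open>x\<close> is \<open>return borel x\<close> and
  \<open>F((-\<infinity>, x])\<close> is \<open>cdf F x\<close>.\<close>

definition compactly_supported_dists :: "real measure set" where
  "compactly_supported_dists =
     {F. real_distribution F \<and> (\<exists>K. compact K \<and> measure F K = 1)}"

definition mixture :: "real \<Rightarrow> real measure \<Rightarrow> real measure \<Rightarrow> real measure" where
  "mixture l F G = measure_of UNIV (sets borel)
     (\<lambda>A. ennreal l * emeasure F A + ennreal (1 - l) * emeasure G A)"

lemma sets_mixture [simp, measurable_cong]: "sets (mixture l F G) = sets borel"
  unfolding mixture_def
  by (metis sets.sets_measure_of_eq space_borel)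

lemma space_mixture [simp]: "space (mixture l F G) = UNIV"
  by (simp add: mixture_def space_measure_of_conv)

lemma emeasure_mixture:
  assumes "sets F = sets borel" "sets G = sets borel" "A \<in> sets borel"
  shows "emeasure (mixture l F G) A =
    ennreal l * emeasure F A + ennreal (1 - l) * emeasure G A"
  unfolding mixture_def
proof (rule emeasure_measure_of_sigma)
  show "sigma_algebra UNIV (sets borel)"
    using sets.sigma_algebra_axioms[of borel] by simp
  show "positive (sets borel)
      (\<lambda>A. ennreal l * emeasure F A + ennreal (1 - l) * emeasure G A)"
    by (simp add: positive_def)
  show "countably_additive (sets borel)
      (\<lambda>A. ennreal l * emeasure F A + ennreal (1 - l) * emeasure G A)"
    using assms(1,2) by (simp add: countably_additive_def suminf_emeasure flip: suminf_add)
qed (fact assms(3))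

lemma real_distribution_mixture:
  assumes "real_distribution F" "real_distribution G" "l \<in> {0..1}"
  shows "real_distribution (mixture l F G)"
proof -
  interpret F: real_distribution F by fact
  interpret G: real_distribution G by fact
  have "emeasure (mixture l F G) UNIV = ennreal l + ennreal (1 - l)"
    using F.emeasure_space_1 G.emeasure_space_1 by (simp add: emeasure_mixture)
  also have "\<dots> = 1"
    using assms(3) by (simp flip: ennreal_plus)
  finally show ?thesis
    by (intro real_distribution.intro prob_spaceI real_distribution_axioms.intro) simp_all
qed

definition convex_dists :: "real measure set \<Rightarrow> bool" where
  "convex_dists M \<longleftrightarrow> (\<forall>F\<in>M. \<forall>G\<in>M. \<forall>l\<in>{0..1}. mixture l F G \<in> M)"

definition p_quasi_convex_on :: "real measure set \<Rightarrow> (real measure \<Rightarrow> real) \<Rightarrow> bool" where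
  "p_quasi_convex_on M \<rho> \<longleftrightarrow>
     (\<forall>F\<in>M. \<forall>G\<in>M. \<forall>l\<in>{0..1}. \<rho> (mixture l F G) \<le> max (\<rho> F) (\<rho> G))"

definition bounded_variation_on :: "real \<Rightarrow> real \<Rightarrow> (real \<Rightarrow> real) \<Rightarrow> bool" where
  "bounded_variation_on a b f \<longleftrightarrow>
     (\<exists>B. \<forall>n (t :: nat \<Rightarrow> real). mono_on {..n} t \<and> t ` {..n} \<subseteq> {a..b} \<longrightarrow>
        (\<Sum>i<n. \<bar>f (t (Suc i)) - f (t i)\<bar>) \<le> B)"

text \<open>Functions on \<open>[0,1]\<close> are represented by total functions whose values outside \<open>[0,1]\<close> are
  unconstrained; nothing below depends on them, since tail probabilities lie in \<open>[0,1]\<close>.\<close>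

definition H_BV :: "(real \<Rightarrow> real) set" where
  "H_BV = {h. bounded_variation_on 0 1 h \<and> h 0 = 0}"

definition I_h :: "(real \<Rightarrow> real) \<Rightarrow> real measure \<Rightarrow> real" where
  "I_h h F = (LINT x:{0..}|lborel. h (measure F {x<..}))
         + (LINT x:{..0}|lborel. h (measure F {x<..}) - h 1)"

text \<open>The Bochner integrals in \<open>I_h\<close> default to 0 for non-integrable integrands.  Finiteness of both
  integrals is therefore expressed separately; it is automatic for \<open>h\<close> in \<open>H_BV\<close> and compactly
  supported \<open>F\<close>.\<close>

definition I_finite :: "(real \<Rightarrow> real) \<Rightarrow> real measure \<Rightarrow> bool" where
  "I_finite h F \<longleftrightarrow>
     set_integrable lborel {0..} (\<lambda>x. h (measure F {x<..})) \<and>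
     set_integrable lborel {..0} (\<lambda>x. h (measure F {x<..}) - h 1)"

definition R_hv :: "(real \<Rightarrow> real) \<Rightarrow> (real \<Rightarrow> real) \<Rightarrow> real measure \<Rightarrow> real" where
  "R_hv h v F = I_h h (distr F borel v)"

definition R_real_valued_on ::
    "real measure set \<Rightarrow> (real \<Rightarrow> real) \<Rightarrow> (real \<Rightarrow> real) \<Rightarrow> bool" where
  "R_real_valued_on M h v \<longleftrightarrow> (\<forall>F\<in>M. I_finite h (distr F borel v))"

definition V_M :: "real measure set \<Rightarrow> (real \<Rightarrow> real) set" where
  "V_M M = {v \<in> borel_measurable borel.
     \<exists>x y z. return borel x \<in> M \<and> return borel y \<in> M \<and> return borel z \<in> M \<and>
             distinct [v x, v y, v z]}"

definition Q0 :: "real measure \<Rightarrow> real" where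
  "Q0 F = Inf {x. cdf F x > 0}"

definition Q1 :: "real measure \<Rightarrow> real" where
  "Q1 F = Inf {x. cdf F x \<ge> 1}"

definition Q_minus :: "real \<Rightarrow> real measure \<Rightarrow> real" where
  "Q_minus \<alpha> F = (if \<alpha> = 0 then Q0 F else if \<alpha> = 1 then Q1 F else Inf {x. cdf F x \<ge> \<alpha>})"

definition Q_plus :: "real \<Rightarrow> real measure \<Rightarrow> real" where
  "Q_plus \<alpha> F = (if \<alpha> = 0 then Q0 F else if \<alpha> = 1 then Q1 F else Inf {x. cdf F x > \<alpha>})"

definition Q_mix :: "real \<Rightarrow> real \<Rightarrow> real measure \<Rightarrow> real" where
  "Q_mix c \<alpha> F = c * Q_plus \<alpha> F + (1 - c) * Q_minus \<alpha> F"

definition S_ab :: "real \<Rightarrow> real \<Rightarrow> real measure \<Rightarrow> real" where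
  "S_ab a b F = a * Q0 F - b * Q1 F"

definition H_CX :: "(real \<Rightarrow> real) set" where
  "H_CX = {h \<in> H_BV. convex_on {0..1} h}"

definition H_QSM :: "(real \<Rightarrow> real) set" where
  "H_QSM = {h \<in> H_BV. \<exists>a b \<alpha> c k. a \<ge> 0 \<and> b \<ge> 0 \<and> \<alpha> \<in> {0..1} \<and> c \<in> {0..1} \<and>
     (\<forall>F\<in>compactly_supported_dists. I_h h F = S_ab a b F + k * Q_mix c \<alpha> F)}"

end

theory Submission
  imports Defs
begin

text \<open>On the mixtures of three point masses with tail probabilities \<open>s \<ge> t\<close>, the functional is, up to a
  constant, \<open>A h(s) + B h(t)\<close> with \<open>A, B > 0\<close>.  If this is quasi-convex on the triangle
  \<open>0 \<le> t \<le> s \<le> 1\<close> and \<open>h\<close> has a jump at \<open>\<beta>\<close>, then moving \<open>s\<close> across the jump while \<open>t\<close> varies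
  below \<open>\<beta>\<close> forces any variation of \<open>h\<close> below \<open>\<beta>\<close> to occur in infinitely many jumps of a fixed
  size, so \<open>h\<close> is constant there; the reflection \<open>h(1 - x)\<close> gives the other side, and \<open>h\<close> is a step
  function.  If \<open>h\<close> is continuous on \<open>(0,1)\<close> but not convex, it has a point of strict local concavity.
  Two such points contradict quasi-convexity, and a single one is a concave kink, which makes the
  increments of \<open>h\<close> on one side grow geometrically at every scale, contradicting continuity.
  Conversely, a convex \<open>h\<close> gives a convex functional, and for a step function \<open>h\<close> of the tail of a
  mixture is dominated pointwise by \<open>h\<close> of the tail of one of the two components.  This comparison
  needs only that the integrals are finite, hence also applies to push-forwards that are not compactly
  supported, where the quantile representation is meaningless.\<close>

subsection \<open>Local concavity\<close>

text \<open>Only symmetric second differences are tested, so adding an affine function to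
  \<open>f\<close> changes nothing.\<close>

definition concave_at :: "(real \<Rightarrow> real) \<Rightarrow> real \<Rightarrow> real \<Rightarrow> bool" where
  "concave_at f x d \<longleftrightarrow> d > 0 \<and> (\<forall>e. 0 < e \<and> e \<le> d \<longrightarrow> f (x + e) + f (x - e) < 2 * f x)"

text \<open>Subtracting the chord gives a function that vanishes at both ends and is positive
  somewhere. At the rightmost point of its maximum, a move to the right strictly lowers it and a
  move to the left does not raise it.\<close>

lemma concave_at_exists:
  fixes f :: "real \<Rightarrow> real"
  assumes "a < b" and cont: "continuous_on {a..b} f" and u: "0 < u" "u < 1"
    and above: "f ((1 - u) * a + u * b) > (1 - u) * f a + u * f b"
  obtains x d where "a \<le> x - d" "x + d \<le> b" "concave_at f x d"
proof -
  define m where "m = (f b - f a) / (b - a)"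
  define g where "g x = f x - f a - m * (x - a)" for x
  have gc: "continuous_on {a..b} g"
    unfolding g_def by (intro continuous_intros cont)
  have ga: "g a = 0" and gb: "g b = 0"
    using \<open>a < b\<close> by (auto simp: g_def m_def)
  define p where "p = (1 - u) * a + u * b"
  have "p = a + u * (b - a)" "p = b - (1 - u) * (b - a)"
    by (simp_all add: p_def algebra_simps)
  moreover have "0 \<le> u * (b - a)" "0 \<le> (1 - u) * (b - a)"
    using assms by auto
  ultimately have pab: "p \<in> {a..b}"
    by (metis add_increasing2 atLeastAtMost_iff diff_le_eq le_add_same_cancel1 order_refl)
  have "m * (p - a) = u * (f b - f a)"
    using \<open>a < b\<close> by (simp add: p_def m_def field_simps)
  then have "g p > 0"
    using above by (simp add: g_def p_def algebra_simps)
  obtain y where y: "y \<in> {a..b}" "\<And>x. x \<in> {a..b} \<Longrightarrow> g x \<le> g y"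
    using continuous_attains_sup[of "{a..b}" g] gc \<open>a < b\<close> by auto
  define S where "S = {a..b} \<inter> g -` {g y}"
  have "closed S"
    unfolding S_def by (intro continuous_closed_preimage gc) auto
  then have "compact S"
    unfolding compact_eq_bounded_closed by (auto simp: S_def intro: bounded_subset[OF bounded_closed_interval])
  moreover have "S \<noteq> {}" using y by (auto simp: S_def)
  ultimately obtain x where x: "x \<in> S" "\<And>z. z \<in> S \<Longrightarrow> z \<le> x"
    by (meson compact_attains_sup)
  have gx: "g x = g y" "x \<in> {a..b}" using x by (auto simp: S_def)
  have "g x > 0" using \<open>g p > 0\<close> y(2)[OF pab] gx by auto
  then have xab: "a < x" "x < b" using gx ga gb by (auto simp: less_le)
  define d where "d = min (x - a) (b - x)"
  have "concave_at f x d"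
    unfolding concave_at_def
  proof (intro conjI allI impI)
    show "d > 0" using xab by (auto simp: d_def)
    fix e assume e: "0 < e \<and> e \<le> d"
    have in': "x + e \<in> {a..b}" "x - e \<in> {a..b}" using e xab by (auto simp: d_def)
    have "x + e \<notin> S" using x(2)[of "x + e"] e by auto
    then have "g (x + e) < g x" using in' y(2)[of "x + e"] gx by (auto simp: S_def less_le)
    moreover have "g (x - e) \<le> g x" using y(2)[of "x - e"] gx in' by auto
    ultimately have "g (x + e) + g (x - e) < 2 * g x" by simp
    then show "f (x + e) + f (x - e) < 2 * f x" by (simp add: g_def algebra_simps)
  qed
  then show ?thesis by (rule that[rotated 2]) (auto simp: d_def)
qed

text \<open>Cut \<open>[a, c]\<close> into \<open>N\<close> equal steps and continue them up to
  \<open>2 * c - a\<close>. Some increment in the first half is at least the average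
  \<open>D / N\<close>, and each later one is larger by the factor \<open>r\<close>. After
  \<open>N\<close> more steps exponential growth beats the factor \<open>1 / N\<close>, while
  uniform continuity keeps all increments below \<open>w\<close>.\<close>

lemma geometric_growth_contradiction:
  fixes f :: "real \<Rightarrow> real"
  assumes "a < c" "f a < f c" and r: "r > 1" and "w > 0" and cont: "continuous_on {a..2 * c - a} f"
    and step: "\<And>t n. \<lbrakk>a \<le> t - n; t + n \<le> 2 * c - a; 0 < n; f (t - n) < f t; f t - f (t - n) \<le> w\<rbrakk>
      \<Longrightarrow> f (t + n) - f t \<ge> r * (f t - f (t - n))"
  shows False
proof -
  define D where "D = f c - f a"
  have D: "D > 0" using assms by (simp add: D_def)
  have "uniformly_continuous_on {a..2 * c - a} f"
    using cont by (intro compact_uniformly_continuous) auto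
  then obtain d where d: "d > 0"
      "\<And>x y. x \<in> {a..2 * c - a} \<Longrightarrow> y \<in> {a..2 * c - a} \<Longrightarrow> dist y x < d \<Longrightarrow> dist (f y) (f x) < w"
    unfolding uniformly_continuous_on_def using \<open>w > 0\<close> by metis
  have "(\<lambda>N. real N * (1 / r) ^ N) \<longlonglongrightarrow> 0"
    using r by (intro powser_times_n_limit_0) simp
  then have "eventually (\<lambda>N. real N * (1 / r) ^ N < D / w) at_top"
    using D \<open>w > 0\<close> by (intro order_tendstoD) auto
  moreover have "eventually (\<lambda>N. real N > (c - a) / d) at_top"
    using filterlim_real_sequentially by (auto simp: filterlim_at_top_dense)
  moreover have "eventually (\<lambda>N::nat. N > 0) at_top"
    by (rule eventually_gt_at_top)
  ultimately have "eventually (\<lambda>N. real N * (1 / r) ^ N < D / w \<and> real N > (c - a) / d \<and> N > 0) at_top"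
    by eventually_elim auto
  then obtain N where N': "real N * (1 / r) ^ N < D / w" "real N > (c - a) / d" "N > 0"
    by (metis (mono_tags, lifting) eventually_happens trivial_limit_sequentially)
  have N: "r ^ N * D / real N > w" "real N > (c - a) / d" "N > 0"
    using N' r \<open>w > 0\<close> by (auto simp: field_simps)
  \<comment> \<open>The mesh is below the modulus \<open>d\<close>, so every increment is at most
    \<open>w\<close> and \<open>step\<close> applies to it.\<close>
  define n where "n = (c - a) / real N"
  have n: "n > 0" "n < d" "real N * n = c - a"
    using N \<open>a < c\<close> d(1) by (auto simp: n_def field_simps)
  define p where "p i = a + real i * n" for i
  have p: "p i \<in> {a..2 * c - a}" if "i \<le> 2 * N" for i
  proof -
    have "real i * n \<le> real (2 * N) * n"
      using that n by (intro mult_right_mono) auto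
    moreover have "real (2 * N) * n = 2 * (c - a)" using n by simp
    ultimately have "real i * n \<le> 2 * (c - a)" by linarith
    moreover have "real i * n \<ge> 0" using n by simp
    ultimately show ?thesis by (auto simp: p_def)
  qed
  define u where "u i = f (p (Suc i)) - f (p i)" for i
  have u_le: "u i \<le> w" if "i < 2 * N" for i
    using d(2)[of "p i" "p (Suc i)"] p[of i] p[of "Suc i"] that n
    by (auto simp: u_def dist_real_def p_def algebra_simps)
  have u_step: "u (Suc i) \<ge> r * u i" if "Suc i < 2 * N" "u i > 0" for i
  proof -
    have eq: "p (Suc i) - n = p i" "p (Suc i) + n = p (Suc (Suc i))"
      by (auto simp: p_def algebra_simps)
    show ?thesis
      using step[of "p (Suc i)" n] p[of i] p[of "Suc (Suc i)"] that u_le[of i] n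
      unfolding eq by (auto simp: u_def)
  qed
  have "(\<Sum>i<N. u i) = f (p N) - f (p 0)"
    unfolding u_def by (rule sum_lessThan_telescope)
  also have "\<dots> = D" using n by (simp add: p_def D_def)
  finally have sum_u: "(\<Sum>i<N. u i) = D" .
  obtain j where j: "j < N" "u j \<ge> D / real N"
  proof (rule ccontr)
    assume "\<not> thesis"
    then have "\<forall>i<N. u i < D / real N" using that by force
    then have "(\<Sum>i<N. u i) < (\<Sum>i<N. D / real N)"
      using N by (intro sum_strict_mono) auto
    then show False using sum_u N by simp
  qed
  have "u (j + k) \<ge> r ^ k * (D / real N)" if "k \<le> N" for k
    using that
  proof (induction k)
    case (Suc k)
    have pos: "r ^ k * (D / real N) > 0" using r D N by auto
    then have "u (j + Suc k) \<ge> r * u (j + k)"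
      using Suc u_step[of "j + k"] j by auto
    moreover have "r * u (j + k) \<ge> r * (r ^ k * (D / real N))"
      using Suc r by (intro mult_left_mono) auto
    ultimately show ?case by simp
  qed (use j in auto)
  \<comment> \<open>As \<open>j < N\<close>, the index \<open>j + N\<close> is still in range, where
    the bound \<open>w\<close> holds.\<close>
  from this[of N] u_le[of "j + N"] j N show False by auto
qed

lemma concave_at_mono: "concave_at f x d \<Longrightarrow> 0 < d' \<Longrightarrow> d' \<le> d \<Longrightarrow> concave_at f x d'"
  by (auto simp: concave_at_def)

lemma between_combination:
  fixes x m y :: real
  assumes "x < m" "m < y"
  obtains l where "0 < l" "l < 1" "m = l * x + (1 - l) * y"
proof (rule that)
  have "(y - m) / (y - x) * x + (1 - (y - m) / (y - x)) * y = y - (y - m) / (y - x) * (y - x)"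
    unfolding right_diff_distrib left_diff_distrib by linarith
  also have "(y - m) / (y - x) * (y - x) = y - m" using assms by simp
  finally show "m = (y - m) / (y - x) * x + (1 - (y - m) / (y - x)) * y"
    by simp
qed (use assms in \<open>auto simp: field_simps\<close>)

lemma const_witness:
  fixes f :: "real \<Rightarrow> real"
  assumes "\<And>x y. \<lbrakk>a < x; x < y; y < b\<rbrakk> \<Longrightarrow> f x = f y"
  shows "\<exists>P. \<forall>x. a < x \<and> x < b \<longrightarrow> f x = P"
proof (intro exI allI impI)
  show "f x = f ((a + b) / 2)" if "a < x \<and> x < b" for x
  proof (cases x "(a + b) / 2" rule: linorder_cases)
    case less
    then show ?thesis using that by (intro assms) auto
  next
    case greater
    then show ?thesis using that by (intro assms[symmetric]) auto
  qed (simp only:)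
qed

subsection \<open>Quasi-convexity on the triangle\<close>

text \<open>\<open>s\<close> and \<open>t\<close> are the two tail probabilities of a three-point
  distribution; \<open>A\<close> and \<open>B\<close> will be the gaps between the three ordered
  values of \<open>v\<close>.\<close>

locale qc_triangle =
  fixes h :: "real \<Rightarrow> real" and A B C :: real
  assumes A_pos: "A > 0" and B_pos: "B > 0"
    and qc: "\<And>s t s' t' l. \<lbrakk>0 \<le> t; t \<le> s; s \<le> 1; 0 \<le> t'; t' \<le> s'; s' \<le> 1; 0 \<le> l; l \<le> 1\<rbrakk> \<Longrightarrow>
      A * h (l * s + (1 - l) * s') + B * h (l * t + (1 - l) * t')
        \<le> max (A * h s + B * h t) (A * h s' + B * h t')"
    and bounded: "\<And>x. 0 \<le> x \<Longrightarrow> x \<le> 1 \<Longrightarrow> \<bar>h x\<bar> \<le> C"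

context qc_triangle
begin

text \<open>The map \<open>(s, t)\<close> to \<open>(1 - t, 1 - s)\<close> preserves the triangle
  and exchanges the two coefficients. It transfers results from the left of a point to its
  right.\<close>

lemma reflect: "qc_triangle (\<lambda>x. h (1 - x)) B A C"
proof
  fix s t s' t' l :: real
  assume *: "0 \<le> t" "t \<le> s" "s \<le> 1" "0 \<le> t'" "t' \<le> s'" "s' \<le> 1" "0 \<le> l" "l \<le> 1"
  have eq: "1 - (l * x + (1 - l) * y) = l * (1 - x) + (1 - l) * (1 - y)" for x y
    by (simp add: algebra_simps)
  show "B * h (1 - (l * s + (1 - l) * s')) + A * h (1 - (l * t + (1 - l) * t'))
      \<le> max (B * h (1 - s) + A * h (1 - t)) (B * h (1 - s') + A * h (1 - t'))"
    using qc[of "1 - s" "1 - t" "1 - s'" "1 - t'" l] * by (simp add: eq add.commute)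
qed (use A_pos B_pos bounded in auto)

text \<open>On the edge \<open>t = 0\<close> of the triangle the \<open>B\<close> term is constant
  and cancels.\<close>

lemma quasi_convex:
  assumes "0 \<le> x" "x \<le> m" "m \<le> y" "y \<le> 1"
  shows "h m \<le> max (h x) (h y)"
proof (cases "x = m \<or> m = y")
  case False
  then obtain l where l: "0 < l" "l < 1" "m = l * x + (1 - l) * y"
    using between_combination[of x m y] assms by auto
  have "A * h m \<le> max (A * h x) (A * h y)"
    using qc[of 0 x 0 y l] assms l by (auto simp: max_def split: if_splits)
  then show ?thesis using A_pos by (auto simp: max_def split: if_splits)
qed auto

text \<open>\<open>d\<close> and \<open>n\<close> are signed, so this covers moves of the two
  arguments in the same and in opposite directions.\<close>

lemma qc_mid:
  assumes "0 \<le> t - n" "t - n \<le> s - d" "s - d \<le> 1" "0 \<le> t + n" "t + n \<le> s + d" "s + d \<le> 1"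
  shows "A * h s + B * h t \<le> max (A * h (s + d) + B * h (t + n)) (A * h (s - d) + B * h (t - n))"
  using qc[of "t + n" "s + d" "t - n" "s - d" "1/2"] assms by (simp add: field_simps)

text \<open>An oscillation at \<open>\<beta>\<close>: points of height about \<open>H\<close> lie between points of height at most about
  \<open>H\<close> and points that are lower by \<open>J\<close>, with arbitrary prescribed weights.\<close>

definition oscillates :: "real \<Rightarrow> real \<Rightarrow> bool" where
  "oscillates \<beta> J \<longleftrightarrow> (\<exists>H. \<forall>e l. 0 < e \<and> 0 < l \<and> l < 1 \<longrightarrow>
     (\<exists>p q. \<beta> - e < p \<and> p \<le> 1 \<and> \<beta> - e < q \<and> q \<le> 1 \<and> h p \<le> H + e \<and> h q \<le> H - J
        \<and> h (l * p + (1 - l) * q) \<ge> H - e))"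

text \<open>Mix the pairs \<open>(p, t1)\<close> and \<open>(q, t2)\<close>, with \<open>p\<close>
  and \<open>q\<close> from the oscillation. The \<open>A\<close> part is near \<open>H\<close> at
  the mixture and at \<open>p\<close>, but lower by \<open>J\<close> at \<open>q\<close>; this
  deficit is charged to the \<open>B\<close> part, and \<open>e\<close> tends to 0.\<close>

lemma oscillates_gap:
  assumes osc: "oscillates \<beta> J" and t: "0 \<le> t1" "t1 < \<beta>" "0 \<le> t2" "t2 < \<beta>" "0 < l" "l < 1"
  shows "h (l * t1 + (1 - l) * t2) \<le> max (h t1) (h t2 - A * J / B)"
proof -
  let ?t = "l * t1 + (1 - l) * t2"
  obtain H where H: "\<And>e l. 0 < e \<Longrightarrow> 0 < l \<Longrightarrow> l < 1 \<Longrightarrow>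
     (\<exists>p q. \<beta> - e < p \<and> p \<le> 1 \<and> \<beta> - e < q \<and> q \<le> 1 \<and> h p \<le> H + e \<and> h q \<le> H - J
        \<and> h (l * p + (1 - l) * q) \<ge> H - e)"
    using osc unfolding oscillates_def by blast
  have "B * h ?t \<le> max (B * h t1) (B * h t2 - A * J) + e" if "e > 0" for e
  proof -
    \<comment> \<open>The first bound makes the total error \<open>2 * A * e'\<close> at most
      \<open>e\<close>; the second keeps \<open>p\<close> and \<open>q\<close> above
      \<open>t1\<close> and \<open>t2\<close>.\<close>
    define e' where "e' = min (e / (2 * A)) (\<beta> - max t1 t2)"
    have e': "e' > 0" "e' \<le> e / (2 * A)" "e' \<le> \<beta> - t1" "e' \<le> \<beta> - t2"
      using that t A_pos by (auto simp: e'_def)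
    then have "2 * A * e' \<le> e"
      using A_pos by (simp add: field_simps)
    obtain p q where pq: "\<beta> - e' < p" "p \<le> 1" "\<beta> - e' < q" "q \<le> 1" "h p \<le> H + e'"
        "h q \<le> H - J" "h (l * p + (1 - l) * q) \<ge> H - e'"
      using H[of e' l] e' t by blast
    have "A * h (l * p + (1 - l) * q) + B * h ?t \<le> max (A * h p + B * h t1) (A * h q + B * h t2)"
      using pq e' t by (intro qc) auto
    moreover have "A * (H - e') \<le> A * h (l * p + (1 - l) * q)" "A * h p \<le> A * (H + e')"
        "A * h q \<le> A * (H - J)"
      using pq A_pos by auto
    ultimately have "A * (H - e') + B * h ?t
        \<le> max (A * (H + e') + B * h t1) (A * (H - J) + B * h t2)"
      by linarith
    then show ?thesis using \<open>2 * A * e' \<le> e\<close> mult_pos_pos[OF A_pos \<open>e' > 0\<close>]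
      by (auto simp: max_def algebra_simps split: if_splits)
  qed
  then have "B * h ?t \<le> max (B * h t1) (B * h t2 - A * J)" by (rule field_le_epsilon)
  then show ?thesis using B_pos
    by (auto simp: max_def field_simps split: if_splits)
qed

lemma oscillates_const:
  assumes osc: "oscillates \<beta> J" and "J > 0" "\<beta> \<le> 1"
  shows "\<And>x y. \<lbrakk>0 < x; x < y; y < \<beta>\<rbrakk> \<Longrightarrow> h x = h y"
    and "\<And>y. \<lbrakk>0 < y; y < \<beta>\<rbrakk> \<Longrightarrow> h y \<le> h 0"
proof -
  define c where "c = A * J / B"
  have c: "c > 0" using A_pos B_pos \<open>J > 0\<close> by (simp add: c_def)
  have gap: "h m \<le> max (h x) (h y - c)"
    if "0 \<le> x" "x < \<beta>" "0 \<le> y" "y < \<beta>" "(x < m \<and> m < y) \<or> (y < m \<and> m < x)" for x m y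
    using that(5)
  proof
    assume "x < m \<and> m < y"
    then obtain l where "0 < l" "l < 1" "m = l * x + (1 - l) * y"
      using between_combination by metis
    then show ?thesis using oscillates_gap[OF osc, of x y l] that by (simp add: c_def)
  next
    assume "y < m \<and> m < x"
    then obtain l where "0 < l" "l < 1" "m = l * y + (1 - l) * x"
      using between_combination by metis
    then show ?thesis using oscillates_gap[OF osc, of x y "1 - l"] that
      by (simp add: c_def add.commute)
  qed
  \<comment> \<open>\<open>n\<close> rises of size \<open>c\<close> exceed the largest possible
    difference of two values of \<open>h\<close>.\<close>
  obtain n :: nat where n: "real n * c > 2 * C"
    using reals_Archimedean3[OF c] by blast
  have up: False if "0 \<le> x" "x < y" "y < \<beta>" "h x < h y" for x y
  proof -
    \<comment> \<open>By induction the midpoint of \<open>y\<close> and \<open>z\<close> lies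
      strictly above \<open>h x\<close>, so the gap inequality between \<open>x\<close> and
      \<open>z\<close> can only hold through \<open>h z\<close>, which is higher by another
      \<open>c\<close>.\<close>
    have *: "h z \<ge> h y + real n * c" if "y < z" "z < \<beta>" for z n
      using that
    proof (induction n arbitrary: z)
      case 0
      then show ?case using gap[of x z y] \<open>0 \<le> x\<close> \<open>x < y\<close> \<open>h x < h y\<close> c by auto
    next
      case (Suc n)
      then have "h ((y + z) / 2) \<ge> h y + real n * c" by auto
      moreover have "real n * c \<ge> 0" using c by simp
      ultimately show ?case
        using gap[of x z "(y + z) / 2"] Suc.prems \<open>0 \<le> x\<close> \<open>x < y\<close> \<open>h x < h y\<close>
        by (auto simp: algebra_simps)
    qed
    have "h ((y + \<beta>) / 2) \<ge> h y + real n * c" by (rule *) (use that in auto)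
    moreover have "\<bar>h ((y + \<beta>) / 2)\<bar> \<le> C" "\<bar>h y\<bar> \<le> C"
      by (intro bounded; use that assms in auto)+
    ultimately show False using n by linarith
  qed
  have down: False if "0 < x" "x < y" "y < \<beta>" "h y < h x" for x y
  proof -
    have *: "h z \<ge> h x + real n * c" if "0 < z" "z < x" for z n
      using that
    proof (induction n arbitrary: z)
      case 0
      then show ?case using gap[of y z x] \<open>x < y\<close> \<open>y < \<beta>\<close> \<open>h y < h x\<close> c by auto
    next
      case (Suc n)
      then have "h ((x + z) / 2) \<ge> h x + real n * c" by auto
      moreover have "real n * c \<ge> 0" using c by simp
      ultimately show ?case
        using gap[of y z "(x + z) / 2"] Suc.prems \<open>x < y\<close> \<open>y < \<beta>\<close> \<open>h y < h x\<close>
        by (auto simp: algebra_simps)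
    qed
    have "h (x / 2) \<ge> h x + real n * c" by (rule *) (use that in auto)
    moreover have "\<bar>h (x / 2)\<bar> \<le> C" "\<bar>h x\<bar> \<le> C"
      by (intro bounded; use that assms in auto)+
    ultimately show False using n by linarith
  qed
  show "h x = h y" if "0 < x" "x < y" "y < \<beta>" for x y
    using up[of x y] down[of x y] that by (cases "h x" "h y" rule: linorder_cases) auto
  show "h y \<le> h 0" if "0 < y" "y < \<beta>" for y
    using up[of 0 y] that by force
qed

section \<open>Oscillation at discontinuities\<close>

text \<open>\<open>H\<close> is the upper limit of \<open>h\<close> at \<beta> relative to
  \<open>[0, 1]\<close>, the value at \<beta> included, obtained as the infimum of all local upper
  bounds.\<close>

lemma upper_envelope:
  assumes "0 \<le> \<beta>" "\<beta> \<le> 1"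
  obtains H where "\<And>e. e > 0 \<Longrightarrow> \<exists>d>0. \<forall>s\<in>{0..1}. \<bar>s - \<beta>\<bar> < d \<longrightarrow> h s \<le> H + e"
    and "\<And>e d. e > 0 \<Longrightarrow> d > 0 \<Longrightarrow> \<exists>s\<in>{0..1}. \<bar>s - \<beta>\<bar> < d \<and> h s > H - e"
proof -
  define S where "S = {u. \<exists>d>0. \<forall>s\<in>{0..1}. \<bar>s - \<beta>\<bar> < d \<longrightarrow> h s \<le> u}"
  have ne: "C \<in> S"
    unfolding S_def using bounded by (auto intro!: exI[of _ 1] simp: abs_le_iff)
  have bdd: "bdd_below S"
    using assms by (intro bdd_belowI[of _ "h \<beta>"]) (auto simp: S_def)
  show ?thesis
  proof (rule that)
    fix e :: real assume "e > 0"
    then obtain u where "u \<in> S" "u < Inf S + e"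
      using cInf_lessD[of S "Inf S + e"] ne by auto
    then show "\<exists>d>0. \<forall>s\<in>{0..1}. \<bar>s - \<beta>\<bar> < d \<longrightarrow> h s \<le> Inf S + e"
      unfolding S_def by (smt (verit) mem_Collect_eq)
  next
    fix e d :: real assume *: "e > 0" "d > 0"
    have "Inf S - e \<notin> S" using cInf_lower[OF _ bdd, of "Inf S - e"] * by auto
    then show "\<exists>s\<in>{0..1}. \<bar>s - \<beta>\<bar> < d \<and> h s > Inf S - e"
      using * unfolding S_def by (auto simp: not_le)
  qed
qed

text \<open>With \<open>H\<close> the upper limit, a discontinuity yields points arbitrarily near
  \<beta> that are lower than \<open>H\<close> by a fixed \<open>J\<close>. For a given weight, a
  high point \<open>m\<close> and a low point \<open>q\<close> are chosen first and \<open>p\<close>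
  is found by extrapolating from \<open>q\<close> through \<open>m\<close>.\<close>

lemma discontinuous_oscillates:
  assumes \<beta>: "0 < \<beta>" "\<beta> < 1" and "\<not> isCont h \<beta>"
  obtains J where "J > 0" "oscillates \<beta> J"
proof -
  obtain H where H1: "\<And>e. e > 0 \<Longrightarrow> \<exists>d>0. \<forall>s\<in>{0..1}. \<bar>s - \<beta>\<bar> < d \<longrightarrow> h s \<le> H + e"
    and H2: "\<And>e d. e > 0 \<Longrightarrow> d > 0 \<Longrightarrow> \<exists>s\<in>{0..1}. \<bar>s - \<beta>\<bar> < d \<and> h s > H - e"
    using upper_envelope[of \<beta>] \<beta> by auto
  have "\<exists>J>0. \<forall>d>0. \<exists>s. \<bar>s - \<beta>\<bar> < d \<and> h s \<le> H - J"
  proof (rule ccontr)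
    assume "\<not> ?thesis"
    then have low: "\<exists>d>0. \<forall>s. \<bar>s - \<beta>\<bar> < d \<longrightarrow> h s > H - J" if "J > 0" for J
      using that by (force simp: not_le)
    have close: "\<exists>d>0. \<forall>s. \<bar>s - \<beta>\<bar> < d \<longrightarrow> \<bar>h s - H\<bar> \<le> e" if e: "e > 0" for e
    proof -
      obtain d1 where d1: "d1 > 0" "\<forall>s\<in>{0..1}. \<bar>s - \<beta>\<bar> < d1 \<longrightarrow> h s \<le> H + e"
        using H1[OF e] by auto
      obtain d2 where d2: "d2 > 0" "\<forall>s. \<bar>s - \<beta>\<bar> < d2 \<longrightarrow> h s > H - e"
        using low[OF e] by auto
      show ?thesis
      proof (intro exI[of _ "min (min d1 d2) (min \<beta> (1 - \<beta>))"] conjI allI impI)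
        fix s assume s: "\<bar>s - \<beta>\<bar> < min (min d1 d2) (min \<beta> (1 - \<beta>))"
        then have "s \<in> {0..1}" by auto
        then show "\<bar>h s - H\<bar> \<le> e" using s d1(2)[rule_format, of s] d2(2)[rule_format, of s] by auto
      qed (use d1 d2 \<beta> in auto)
    qed
    have "\<bar>h \<beta> - H\<bar> \<le> e" if "e > 0" for e
      using close[OF that] by auto
    then have "\<bar>h \<beta> - H\<bar> \<le> 0" by (metis field_le_epsilon add_0)
    then have hH: "h \<beta> = H" by simp
    have "isCont h \<beta>"
      unfolding continuous_at_eps_delta
    proof (intro allI impI)
      fix e :: real assume "e > 0"
      then show "\<exists>d>0. \<forall>x'. dist x' \<beta> < d \<longrightarrow> dist (h x') (h \<beta>) < e"
        using close[of "e / 2"] hH by (force simp: dist_real_def)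
    qed
    with assms show False by simp
  qed
  then obtain J where J: "J > 0" "\<And>d. d > 0 \<Longrightarrow> \<exists>s. \<bar>s - \<beta>\<bar> < d \<and> h s \<le> H - J"
    by blast
  have "oscillates \<beta> J"
    unfolding oscillates_def
  proof (rule exI[of _ H], intro allI impI)
    fix e l :: real assume el: "0 < e \<and> 0 < l \<and> l < 1"
    obtain d where d: "d > 0" "\<forall>s\<in>{0..1}. \<bar>s - \<beta>\<bar> < d \<longrightarrow> h s \<le> H + e"
      using H1[of e] el by auto
    define d' where "d' = min (min d e) (min \<beta> (1 - \<beta>))"
    have d': "d' > 0" using d \<beta> el by (auto simp: d'_def)
    \<comment> \<open>Extrapolation magnifies distances from \<beta> by at most
      \<open>2 / l\<close>, so \<open>p\<close> stays within \<open>d'\<close>.\<close>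
    define d'' where "d'' = d' * l / 2"
    have d'': "d'' > 0" "d'' \<le> d'" using d' el by (auto simp: d''_def field_simps)
    obtain m where m: "\<bar>m - \<beta>\<bar> < d''" "h m > H - e"
      using H2[of e d''] d'' el by auto
    obtain q where q: "\<bar>q - \<beta>\<bar> < d''" "h q \<le> H - J"
      using J(2)[OF d''(1)] by auto
    define p where "p = (m - (1 - l) * q) / l"
    have meq: "m = l * p + (1 - l) * q" using el by (simp add: p_def)
    have "l * (p - \<beta>) = (m - \<beta>) - (1 - l) * (q - \<beta>)" by (simp add: meq algebra_simps)
    moreover have "\<bar>(1 - l) * (q - \<beta>)\<bar> \<le> \<bar>q - \<beta>\<bar>"
      using el by (simp add: abs_mult mult_left_le_one_le)
    ultimately have "\<bar>l * (p - \<beta>)\<bar> < 2 * d''" using m q by linarith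
    then have "l * \<bar>p - \<beta>\<bar> < l * d'" using el by (simp add: abs_mult d''_def mult.commute)
    then have p: "\<bar>p - \<beta>\<bar> < d'" using el by simp
    have "p \<in> {0..1}" "q \<le> 1" "\<beta> - e < p" "\<beta> - e < q" "\<bar>p - \<beta>\<bar> < d"
      using p q d'' by (auto simp: d'_def)
    with d m q show "\<exists>p q. \<beta> - e < p \<and> p \<le> 1 \<and> \<beta> - e < q \<and> q \<le> 1 \<and> h p \<le> H + e \<and> h q \<le> H - J
        \<and> h (l * p + (1 - l) * q) \<ge> H - e"
      by (intro exI[of _ q, THEN exI[of _ p]]) (auto simp flip: meq)
  qed
  with J that show ?thesis by blast
qed

text \<open>Here the low point \<open>q\<close> is 1 itself; extrapolating from 1 through a high
  point \<open>m \<le> 1\<close> never leaves the interval to the right.\<close>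

lemma not_usc_right_end_oscillates:
  assumes "e0 > 0" and nusc: "\<And>d. d > 0 \<Longrightarrow> \<exists>s\<in>{0..1}. \<bar>s - 1\<bar> < d \<and> h s > h 1 + e0"
  shows "oscillates 1 e0"
proof -
  obtain H where H1: "\<And>e. e > 0 \<Longrightarrow> \<exists>d>0. \<forall>s\<in>{0..1}. \<bar>s - 1\<bar> < d \<longrightarrow> h s \<le> H + e"
    and H2: "\<And>e d. e > 0 \<Longrightarrow> d > 0 \<Longrightarrow> \<exists>s\<in>{0..1}. \<bar>s - 1\<bar> < d \<and> h s > H - e"
    using upper_envelope[of 1] by auto
  have "h 1 + e0 \<le> H"
  proof (rule field_le_epsilon)
    fix e :: real assume "e > 0"
    obtain d where d: "d > 0" "\<forall>s\<in>{0..1}. \<bar>s - 1\<bar> < d \<longrightarrow> h s \<le> H + e"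
      using H1[OF \<open>e > 0\<close>] by blast
    obtain s where "s \<in> {0..1}" "\<bar>s - 1\<bar> < d" "h s > h 1 + e0" using nusc[OF d(1)] by blast
    then show "h 1 + e0 \<le> H + e" using d by force
  qed
  show ?thesis
    unfolding oscillates_def
  proof (rule exI[of _ H], intro allI impI)
    fix e l :: real assume el: "0 < e \<and> 0 < l \<and> l < 1"
    obtain d where d: "d > 0" "\<forall>s\<in>{0..1}. \<bar>s - 1\<bar> < d \<longrightarrow> h s \<le> H + e"
      using H1[of e] el by auto
    define d' where "d' = min (min d e) 1"
    have d': "d' > 0" using d el by (auto simp: d'_def)
    obtain m where m: "\<bar>m - 1\<bar> < d' * l" "h m > H - e" "m \<le> 1"
      using H2[of e "d' * l"] d' el by auto
    define p where "p = 1 - (1 - m) / l"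
    have meq: "m = l * p + (1 - l) * 1" using el by (simp add: p_def field_simps)
    have "1 - p < d'" "p \<le> 1"
      using m el by (auto simp: p_def field_simps)
    then have "p \<in> {0..1}" "1 - e < p" "\<bar>p - 1\<bar> < d"
      by (auto simp: d'_def)
    with d m el \<open>h 1 + e0 \<le> H\<close>
    show "\<exists>p q. 1 - e < p \<and> p \<le> 1 \<and> 1 - e < q \<and> q \<le> 1 \<and> h p \<le> H + e \<and> h q \<le> H - e0
        \<and> h (l * p + (1 - l) * q) \<ge> H - e"
      by (intro exI[of _ 1, THEN exI[of _ p]]) (auto simp: meq[symmetric, simplified])
  qed
qed

section \<open>Points of strict local concavity\<close>

text \<open>Choose symmetric moves around \<open>t\<close> and \<open>s\<close> whose weighted
  changes have equal size. Paired in the right direction, they give two end points with the same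
  value of the functional. Quasi-convexity puts the midpoint at or below this value, strict
  concavity puts it above.\<close>

lemma no_two_concave_points:
  assumes cont: "\<And>x. 0 < x \<Longrightarrow> x < 1 \<Longrightarrow> isCont h x"
    and t: "concave_at h t a" "0 < t - a" and ts: "t + a < s - b" and s: "concave_at h s b" "s + b < 1"
  shows False
proof -
  have pos: "a > 0" "b > 0" using t s by (auto simp: concave_at_def)
  \<comment> \<open>The weighted change is continuous in \<open>e\<close> and 0 at
    \<open>e = 0\<close>, so it takes every value up to the one at \<open>d\<close>.\<close>
  have attained: "\<exists>e. 0 < e \<and> e \<le> d \<and> k * \<bar>h (x + e) - h (x - e)\<bar> = v"
    if "concave_at h x d" "0 < x - d" "x + d < 1" "v > 0" "v \<le> k * \<bar>h (x + d) - h (x - d)\<bar>"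
    for x d k v
  proof -
    have "\<exists>e. 0 \<le> e \<and> e \<le> d \<and> k * \<bar>h (x + e) - h (x - e)\<bar> = v"
    proof (rule IVT')
      show "continuous_on {0..d} (\<lambda>e. k * \<bar>h (x + e) - h (x - e)\<bar>)"
      proof (intro continuous_at_imp_continuous_on ballI)
        fix e assume "e \<in> {0..d}"
        then have "isCont h (x + e)" "isCont h (x - e)" using that by (auto intro!: cont)
        then show "isCont (\<lambda>e. k * \<bar>h (x + e) - h (x - e)\<bar>) e"
          by (auto intro!: continuous_intros isCont_o2[where g = h])
      qed
    qed (use that in \<open>auto simp: concave_at_def\<close>)
    then obtain e where "0 \<le> e" "e \<le> d" "k * \<bar>h (x + e) - h (x - e)\<bar> = v" by auto
    moreover have "e \<noteq> 0" using calculation that by auto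
    ultimately show ?thesis by (intro exI[of _ e]) auto
  qed
  \<comment> \<open>Equal values on both sides would place \<open>h x\<close> strictly above both,
    against quasi-convexity of \<open>h\<close>.\<close>
  have nz: "h (x + d) \<noteq> h (x - d)" if "concave_at h x d" "0 < x - d" "x + d < 1" for x d
    using that quasi_convex[of "x - d" x "x + d"]
    by (auto simp: concave_at_def dest!: spec[of _ d])
  \<comment> \<open>A common size that the moves at both points can reach.\<close>
  define v where "v = min (B * \<bar>h (t + a) - h (t - a)\<bar>) (A * \<bar>h (s + b) - h (s - b)\<bar>)"
  have v: "v > 0" using nz[of t a] nz[of s b] A_pos B_pos t s ts pos by (auto simp: v_def)
  obtain e where e: "0 < e" "e \<le> a" "B * \<bar>h (t + e) - h (t - e)\<bar> = v"
    using attained[of t a v B] t s ts v pos by (auto simp: v_def)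
  obtain e' where e': "0 < e'" "e' \<le> b" "A * \<bar>h (s + e') - h (s - e')\<bar> = v"
    using attained[of s b v A] t s ts v pos by (auto simp: v_def)
  have "h (t + e) + h (t - e) < 2 * h t" "h (s + e') + h (s - e') < 2 * h s"
    using t s e e' by (auto simp: concave_at_def)
  then have "B * (h (t + e) + h (t - e)) < B * (2 * h t)" "A * (h (s + e') + h (s - e')) < A * (2 * h s)"
    using A_pos B_pos by (auto simp del: distrib_left_numeral)
  then have lt: "A * h (s + e') + A * h (s - e') + B * h (t + e) + B * h (t - e) < 2 * (A * h s + B * h t)"
    by (simp add: algebra_simps)
  have "\<bar>A * (h (s + e') - h (s - e'))\<bar> = \<bar>B * (h (t + e) - h (t - e))\<bar>"
    using e e' A_pos B_pos by (simp add: abs_mult)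
  then have "A * (h (s + e') - h (s - e')) = B * (h (t + e) - h (t - e)) \<or>
      A * (h (s + e') - h (s - e')) = - (B * (h (t + e) - h (t - e)))"
    by (simp only: abs_eq_iff)
  moreover have "A * h s + B * h t \<le> max (A * h (s + e') + B * h (t + e)) (A * h (s - e') + B * h (t - e))"
    using e e' t s ts pos by (intro qc_mid) auto
  moreover have "A * h s + B * h t \<le> max (A * h (s + e') + B * h (t - e)) (A * h (s - e') + B * h (t + e))"
    using e e' t s ts pos qc_mid[of t "- e" s e'] by auto
  ultimately show False using lt
    by (auto simp: algebra_simps max_def split: if_splits)
qed

lemma concave_point_unique:
  assumes cont: "\<And>x. 0 < x \<Longrightarrow> x < 1 \<Longrightarrow> isCont h x"
    and t: "concave_at h t a" "0 < t" "t < 1" and s: "concave_at h s b" "0 < s" "s < 1"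
  shows "s = t"
proof -
  have False if "concave_at h t a" "concave_at h s b" "0 < t" "t < s" "s < 1" for t a s b
  proof (rule no_two_concave_points[OF cont])
    \<comment> \<open>A third of the available room keeps the two windows disjoint and inside
      \<open>(0, 1)\<close>.\<close>
    define c where "c = min (min a b) (min (min t (1 - s)) (s - t)) / 3"
    have "c > 0" using that by (auto simp: c_def concave_at_def)
    moreover have "3 * c \<le> a" "3 * c \<le> b" "3 * c \<le> t" "3 * c \<le> 1 - s" "3 * c \<le> s - t"
      by (auto simp: c_def)
    ultimately have "c > 0" "c \<le> a" "c \<le> b" "0 < t - c" "t + c < s - c" "s + c < 1"
      by linarith+
    then show "concave_at h t c" "concave_at h s c" "0 < t - c" "t + c < s - c" "s + c < 1"
      using that by (auto intro: concave_at_mono)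
  qed auto
  then show ?thesis using t s by (metis linorder_neqE_linordered_idom)
qed

lemma below_chord:
  assumes cont: "\<And>x. 0 < x \<Longrightarrow> x < 1 \<Longrightarrow> isCont h x"
    and ab: "0 < a" "a < b" "b < 1" and nc: "\<And>x d. a < x \<Longrightarrow> x < b \<Longrightarrow> \<not> concave_at h x d"
    and u: "0 < u" "u < 1"
  shows "h ((1 - u) * a + u * b) \<le> (1 - u) * h a + u * h b"
proof (rule ccontr)
  assume "\<not> ?thesis"
  moreover have "continuous_on {a..b} h"
    using ab by (intro continuous_at_imp_continuous_on) (auto intro: cont)
  ultimately obtain x d where "a \<le> x - d" "x + d \<le> b" "concave_at h x d"
    using concave_at_exists[of a b h u] ab u by (auto simp: not_le)
  then show False using nc[of x d] by (auto simp: concave_at_def)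
qed

text \<open>As the only point of strict local concavity, \<open>x\<close> is a kink:
  \<open>h\<close> lies below its chords on either side, so near \<open>x\<close> its drop to the
  left is at least \<open>L * e\<close> and its rise to the right at most \<open>R * e\<close>, with
  \<open>R < L\<close>. Play \<open>s = x\<close> against some \<open>t\<close> further left, moving
  them in opposite directions. If the increment of \<open>h\<close> before \<open>t\<close> is worth
  a slope \<open>K\<close> between \<open>R\<close> and \<open>L\<close>, then quasi-convexity
  forces the next increment to be larger by the factor \<open>L / K\<close>.\<close>

lemma no_concave_point_increasing:
  assumes cont: "\<And>x. 0 < x \<Longrightarrow> x < 1 \<Longrightarrow> isCont h x"
    and x: "concave_at h x d" "0 < x - d" "x + d < 1" and incr: "h x \<le> h (x + d)"
  shows False
proof -
  have d: "d > 0" using x by (simp add: concave_at_def)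
  have nc: "\<not> concave_at h y e" if "0 < y" "y < 1" "y \<noteq> x" for y e
    using concave_point_unique[OF cont, of x d y e] x d that by auto
  have chord: "h ((1 - u) * a + u * b) \<le> (1 - u) * h a + u * h b"
    if "0 < a" "a < b" "b < 1" "x \<notin> {a<..<b}" "0 < u" "u < 1" for a b u
    by (rule below_chord[OF cont]) (use that nc in auto)
  define L R where "L = (h x - h (x - d)) / d" and "R = (h (x + d) - h x) / d"
  have "h (x + d) - h x < h x - h (x - d)" using x d by (auto simp: concave_at_def dest: spec[of _ d])
  then have "R < L" using d by (simp add: L_def R_def divide_strict_right_mono)
  have "R \<ge> 0" using incr d by (simp add: R_def)
  have Lb: "h x - h (x - e) \<ge> L * e" and Rb: "h (x + e) - h x \<le> R * e" if "0 < e" "e \<le> d" for e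
  proof -
    have "h x - h (x - e) \<ge> L * e \<and> h (x + e) - h x \<le> R * e"
    proof (cases "e = d")
      case True
      then show ?thesis using d by (auto simp: L_def R_def)
    next
      case False
      define u where "u = e / d"
      have u: "0 < u" "u < 1" "e = u * d" using that False d by (auto simp: u_def)
      have "h ((1 - u) * x + u * (x + d)) \<le> (1 - u) * h x + u * h (x + d)"
        using chord[of x "x + d" u] u x d by auto
      moreover have "h ((1 - (1 - u)) * (x - d) + (1 - u) * x) \<le> (1 - (1 - u)) * h (x - d) + (1 - u) * h x"
        using chord[of "x - d" x "1 - u"] u x d by auto
      moreover have "(1 - u) * x + u * (x + d) = x + e"
          "(1 - (1 - u)) * (x - d) + (1 - u) * x = x - e"
        unfolding u by (simp_all add: algebra_simps)
      moreover have "L * e = u * (h x - h (x - d))" "R * e = u * (h (x + d) - h x)"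
        using d by (simp_all add: L_def R_def u_def)
      ultimately show ?thesis by (simp add: algebra_simps)
    qed
    then show "h x - h (x - e) \<ge> L * e" "h (x + e) - h x \<le> R * e" by auto
  qed
  define K where "K = (L + R) / 2"
  have K: "R < K" "K < L" "K > 0" using \<open>R < L\<close> \<open>R \<ge> 0\<close> by (auto simp: K_def)
  have "L > 0" using K by simp
  have "h x - h (x - d) > 0" using d \<open>L > 0\<close> Lb[of d] mult_pos_pos[of L d] by linarith
  moreover have "isCont h x" using x d by (intro cont) auto
  ultimately obtain r where r: "r > 0" "\<And>y. \<bar>y - x\<bar> < r \<Longrightarrow> \<bar>h y - h x\<bar> < h x - h (x - d)"
    unfolding continuous_at_eps_delta dist_real_def by meson
  \<comment> \<open>Continuity at \<open>x\<close> keeps \<open>h c\<close> above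
    \<open>h (x - d)\<close>.\<close>
  define c where "c = x - min r d / 2"
  have c: "x - d < c" "c < x" "h (x - d) < h c"
  proof -
    show "x - d < c" "c < x" using r(1) d by (auto simp: c_def min_def)
    have "\<bar>c - x\<bar> < r" using r(1) d by (auto simp: c_def min_def)
    then show "h (x - d) < h c" using r(2)[of c] by auto
  qed
  \<comment> \<open>\<open>a\<close> is so close to \<open>c\<close> that the whole interval from
    \<open>a\<close> to \<open>2 * c - a\<close> lies strictly between \<open>x - d\<close> and
    \<open>x\<close>.\<close>
  define a where "a = max ((x - d + c) / 2) (c - (x - c) / 2)"
  have "(x - d + c) / 2 \<le> a" "c - (x - c) / 2 \<le> a" "a < c" using c by (auto simp: a_def)
  then have a: "x - d < a" "a < c" "2 * c - a < x" using c by (auto simp: field_simps)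
  have hac: "h a < h c"
  proof -
    define u where "u = (a - (x - d)) / (c - (x - d))"
    have u: "0 < u" "u < 1" using a c by (auto simp: u_def)
    have "u * (c - (x - d)) = a - (x - d)" using c by (simp add: u_def)
    then have "(1 - u) * (x - d) + u * c = a" by (simp add: algebra_simps)
    then have "h a \<le> (1 - u) * h (x - d) + u * h c"
      using chord[of "x - d" c u] u x c by auto
    also have "\<dots> < (1 - u) * h c + u * h c" using c u by simp
    finally show ?thesis by (simp add: algebra_simps)
  qed
  \<comment> \<open>For \<open>e \<le> m\<close> the slope bounds apply and \<open>x - e\<close>
    stays to the right of \<open>t + n\<close>, as the triangle demands.\<close>
  define m where "m = min d (x - (2 * c - a))"
  have m: "m > 0" "m \<le> d" "2 * c - a \<le> x - m" using d a by (auto simp: m_def)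
  show False
  proof (rule geometric_growth_contradiction[of a c h "L / K" "A * K * m / B"])
    show "L / K > 1" "A * K * m / B > 0" using K m A_pos B_pos by auto
    show "continuous_on {a..2 * c - a} h"
      using x a by (intro continuous_at_imp_continuous_on) (auto intro!: cont)
    fix t n assume tn: "a \<le> t - n" "t + n \<le> 2 * c - a" "0 < n" "h (t - n) < h t"
      "h t - h (t - n) \<le> A * K * m / B"
    let ?l = "h t - h (t - n)"
    \<comment> \<open>Calibrated so that a rise of slope \<open>K\<close> at \<open>x\<close>
      balances the loss at \<open>t\<close>. The true slope to the right of \<open>x\<close> is
      below \<open>K\<close>, so the end point \<open>(x + e, t - n)\<close> lies below the midpoint
      and the other one must dominate.\<close>
    define e where "e = B * ?l / (A * K)"
    have e: "e > 0" "e \<le> m" "A * (K * e) = B * ?l"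
      using tn K A_pos B_pos by (auto simp: e_def field_simps)
    have "A * h x + B * h t \<le> max (A * h (x + e) + B * h (t - n)) (A * h (x - e) + B * h (t + n))"
      using qc_mid[of t "- n" x e] tn e m a x c by auto
    moreover have "A * h (x + e) + B * h (t - n) < A * h x + B * h t"
    proof -
      have "h (x + e) - h x \<le> R * e" using Rb[of e] e m by auto
      also have "\<dots> < K * e" using K e by simp
      finally have "A * (h (x + e) - h x) < A * (K * e)" using A_pos by simp
      then show ?thesis using e by (simp add: algebra_simps)
    qed
    ultimately have "A * (h x - h (x - e)) \<le> B * (h (t + n) - h t)"
      by (auto simp: algebra_simps)
    moreover have "A * (L * e) \<le> A * (h x - h (x - e))"
      using Lb[of e] e m A_pos by auto
    ultimately have "A * (L * e) \<le> B * (h (t + n) - h t)" by linarith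
    also have "A * (L * e) = B * (L / K * ?l)"
      using A_pos K by (simp add: e_def)
    finally show "h (t + n) - h t \<ge> L / K * ?l" using B_pos by (simp only: mult_le_cancel_left_pos)
  qed (use a hac in auto)
qed

text \<open>By quasi-convexity \<open>h\<close> does not fall on both sides of \<open>x\<close>; the
  side on which it does not fall can be taken to be the right one by reflection.\<close>

lemma no_concave_point:
  assumes cont: "\<And>x. 0 < x \<Longrightarrow> x < 1 \<Longrightarrow> isCont h x" and x: "0 < x" "x < 1"
  shows "\<not> concave_at h x d"
proof
  assume c: "concave_at h x d"
  define e where "e = min d (min x (1 - x)) / 2"
  have "0 < e" using c x by (auto simp: e_def concave_at_def)
  moreover have "2 * e \<le> d" "2 * e \<le> x" "2 * e \<le> 1 - x" by (auto simp: e_def)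
  ultimately have e: "0 < e" "e \<le> d" "0 < x - e" "x + e < 1" by linarith+
  have ce: "concave_at h x e" using c e by (auto intro: concave_at_mono)
  show False
  proof (cases "h x \<le> h (x + e)")
    case True
    then show ?thesis using no_concave_point_increasing[OF cont ce] e by auto
  next
    case False
    then have *: "h x \<le> h (x - e)" using quasi_convex[of "x - e" x "x + e"] e by auto
    interpret r: qc_triangle "\<lambda>x. h (1 - x)" B A C by (rule reflect)
    have "isCont (\<lambda>x. h (1 - x)) y" if "0 < y" "y < 1" for y
      using cont[of "1 - y"] that by (auto intro!: isCont_o2[where g = h] continuous_intros)
    moreover have "concave_at (\<lambda>x. h (1 - x)) (1 - x) e"
      using ce by (auto simp: concave_at_def algebra_simps)
    ultimately show False
      using r.no_concave_point_increasing[of "1 - x" e] e * by (auto simp: algebra_simps)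
  qed
qed

section \<open>Classification of \<open>h\<close>\<close>

definition usc_at :: "real \<Rightarrow> bool" where
  "usc_at x \<longleftrightarrow> (\<forall>e>0. \<exists>d>0. \<forall>y\<in>{0..1}. \<bar>y - x\<bar> < d \<longrightarrow> h y \<le> h x + e)"

text \<open>Inside \<open>(0, 1)\<close> the absence of concave points gives the chord inequality.
  Chords that reach an end point are approximated from inside; upper semicontinuity bounds the
  values at the moved ends.\<close>

lemma convex_if_usc:
  assumes cont: "\<And>x. 0 < x \<Longrightarrow> x < 1 \<Longrightarrow> isCont h x" and "usc_at 0" "usc_at 1"
  shows "convex_on {0..1} h"
proof (rule convex_on_linorderI)
  have usc: "usc_at x" if "x \<in> {0..1}" for x
  proof (cases "x = 0 \<or> x = 1")
    case False
    then have "isCont h x" using that by (intro cont) auto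
    then have "\<exists>d>0. \<forall>y. \<bar>y - x\<bar> < d \<longrightarrow> \<bar>h y - h x\<bar> < e" if "e > 0" for e
      using that unfolding continuous_at_eps_delta dist_real_def by auto
    then show ?thesis unfolding usc_at_def by (meson abs_diff_less_iff less_imp_le)
  qed (use assms in auto)
  fix u x y :: real
  assume u: "0 < u" "u < 1" and xy: "x \<in> {0..1}" "y \<in> {0..1}" "x < y"
  define m where "m = (1 - u) * x + u * y"
  have m: "x < m" "m < y"
  proof -
    have "m = x + u * (y - x)" "m = y - (1 - u) * (y - x)" by (simp_all add: m_def algebra_simps)
    moreover have "u * (y - x) > 0" "(1 - u) * (y - x) > 0" using u xy by auto
    ultimately show "x < m" "m < y" by linarith+
  qed
  show "h ((1 - u) *\<^sub>R x + u *\<^sub>R y) \<le> (1 - u) * h x + u * h y"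
  proof (rule field_le_epsilon)
    fix e :: real assume "e > 0"
    obtain d1 where d1: "d1 > 0" "\<And>z. z \<in> {0..1} \<Longrightarrow> \<bar>z - x\<bar> < d1 \<Longrightarrow> h z \<le> h x + e"
      using usc[OF xy(1)] \<open>e > 0\<close> unfolding usc_at_def by meson
    obtain d2 where d2: "d2 > 0" "\<And>z. z \<in> {0..1} \<Longrightarrow> \<bar>z - y\<bar> < d2 \<Longrightarrow> h z \<le> h y + e"
      using usc[OF xy(2)] \<open>e > 0\<close> unfolding usc_at_def by meson
    define \<theta> where "\<theta> = min 1 (min d1 d2) / 2"
    have "0 < \<theta>" "2 * \<theta> \<le> 1" "2 * \<theta> \<le> d1" "2 * \<theta> \<le> d2" using d1 d2 by (auto simp: \<theta>_def)
    then have \<theta>: "0 < \<theta>" "\<theta> < 1" "\<theta> < d1" "\<theta> < d2" by linarith+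
    \<comment> \<open>Both ends contract towards \<open>m\<close> by the same factor, so
      \<open>m\<close> keeps its weights.\<close>
    define x' y' where "x' = x + \<theta> * (m - x)" and "y' = y - \<theta> * (y - m)"
    have shrink: "0 < \<theta> * z" "\<theta> * z < z" "\<theta> * z \<le> \<theta>" if "0 < z" "z \<le> 1" for z
      using that \<theta> by (auto intro: mult_left_le)
    have "m - x > 0" "m - x \<le> 1" "y - m > 0" "y - m \<le> 1" using m xy by auto
    then have x'y': "x < x'" "x' < m" "m < y'" "y' < y" "x' - x < d1" "y - y' < d2"
      unfolding x'_def y'_def using \<theta> shrink[of "m - x"] shrink[of "y - m"] by linarith+
    have "(1 - u) * x' + u * y' = m"
      by (simp add: x'_def y'_def m_def algebra_simps)
    moreover have "h ((1 - u) * x' + u * y') \<le> (1 - u) * h x' + u * h y'"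
      using x'y' xy u by (intro below_chord cont no_concave_point) auto
    ultimately have "h m \<le> (1 - u) * h x' + u * h y'" by simp
    also have "\<dots> \<le> (1 - u) * (h x + e) + u * (h y + e)"
      using u x'y' xy by (intro add_mono mult_left_mono d1 d2) auto
    also have "\<dots> = (1 - u) * h x + u * h y + e" by (simp add: algebra_simps)
    finally show "h ((1 - u) *\<^sub>R x + u *\<^sub>R y) \<le> (1 - u) * h x + u * h y + e"
      by (simp add: m_def)
  qed
qed auto

lemma not_usc_right_end_const:
  assumes "\<not> usc_at 1" "0 < x" "x < y" "y < 1"
  shows "h x = h y"
proof -
  obtain e where e: "e > 0" "\<And>d. d > 0 \<Longrightarrow> \<exists>s\<in>{0..1}. \<bar>s - 1\<bar> < d \<and> h s > h 1 + e"
    using assms(1) unfolding usc_at_def by (auto simp: not_le)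
  show ?thesis
    by (rule oscillates_const(1)[OF not_usc_right_end_oscillates[OF e] e(1)]) (use assms in auto)
qed

lemma discontinuous_const:
  assumes "0 < \<beta>" "\<beta> < 1" "\<not> isCont h \<beta>"
  shows "\<And>x y. \<lbrakk>0 < x; x < y; y < \<beta>\<rbrakk> \<Longrightarrow> h x = h y"
    and "\<And>y. \<lbrakk>0 < y; y < \<beta>\<rbrakk> \<Longrightarrow> h y \<le> h 0"
    and "\<And>x y. \<lbrakk>\<beta> < x; x < y; y < 1\<rbrakk> \<Longrightarrow> h x = h y"
    and "\<And>y. \<lbrakk>\<beta> < y; y < 1\<rbrakk> \<Longrightarrow> h y \<le> h 1"
proof -
  obtain J where J: "J > 0" "oscillates \<beta> J"
    using discontinuous_oscillates assms by blast
  show "h x = h y" if "0 < x" "x < y" "y < \<beta>" for x y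
    using oscillates_const(1)[OF J(2,1), of x y] that assms by auto
  show "h y \<le> h 0" if "0 < y" "y < \<beta>" for y
    using oscillates_const(2)[OF J(2,1), of y] that assms by auto
  interpret r: qc_triangle "\<lambda>x. h (1 - x)" B A C by (rule reflect)
  have "\<not> isCont (\<lambda>x. h (1 - x)) (1 - \<beta>)"
  proof
    assume "isCont (\<lambda>x. h (1 - x)) (1 - \<beta>)"
    then have "isCont (\<lambda>y. (\<lambda>x. h (1 - x)) (1 - y)) \<beta>"
      by (rule isCont_o2[rotated]) (intro continuous_intros)
    with assms show False by simp
  qed
  then obtain J' where J': "J' > 0" "r.oscillates (1 - \<beta>) J'"
    using r.discontinuous_oscillates[of "1 - \<beta>"] assms by auto
  show "h x = h y" if "\<beta> < x" "x < y" "y < 1" for x y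
    using r.oscillates_const(1)[OF J'(2,1), of "1 - y" "1 - x"] that assms by auto
  show "h y \<le> h 1" if "\<beta> < y" "y < 1" for y
    using r.oscillates_const(2)[OF J'(2,1), of "1 - y"] that assms by auto
qed

text \<open>An interior discontinuity leaves constants on both of its sides. If \<open>h\<close> is
  continuous inside but not upper semicontinuous at an end, then it is constant inside. Otherwise it
  is convex.\<close>

lemma convex_or_step:
  obtains "convex_on {0..1} h"
  | P where "\<And>x. 0 < x \<Longrightarrow> x < 1 \<Longrightarrow> h x = P" "P \<le> max (h 0) (h 1)"
  | \<beta> P1 P2 where "0 < \<beta>" "\<beta> < 1" "\<And>x. 0 < x \<Longrightarrow> x < \<beta> \<Longrightarrow> h x = P1"
      "\<And>x. \<beta> < x \<Longrightarrow> x < 1 \<Longrightarrow> h x = P2" "P1 \<le> h 0" "P2 \<le> h 1"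
      "min P1 P2 \<le> h \<beta>" "h \<beta> \<le> max P1 P2"
proof (cases "\<forall>x. 0 < x \<longrightarrow> x < 1 \<longrightarrow> isCont h x")
  case False
  then obtain \<beta> where \<beta>: "0 < \<beta>" "\<beta> < 1" "\<not> isCont h \<beta>" by auto
  obtain P1 where "\<forall>x. 0 < x \<and> x < \<beta> \<longrightarrow> h x = P1"
    using const_witness[of 0 \<beta> h, OF discontinuous_const(1)[OF \<beta>]] ..
  then have P1: "\<And>x. 0 < x \<Longrightarrow> x < \<beta> \<Longrightarrow> h x = P1" by simp
  obtain P2 where "\<forall>x. \<beta> < x \<and> x < 1 \<longrightarrow> h x = P2"
    using const_witness[of \<beta> 1 h, OF discontinuous_const(3)[OF \<beta>]] ..
  then have P2: "\<And>x. \<beta> < x \<Longrightarrow> x < 1 \<Longrightarrow> h x = P2" by simp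
  have ends: "P1 \<le> h 0" "P2 \<le> h 1"
    using discontinuous_const(2)[OF \<beta>, of "\<beta> / 2"] discontinuous_const(4)[OF \<beta>, of "(\<beta> + 1) / 2"]
      P1[of "\<beta> / 2"] P2[of "(\<beta> + 1) / 2"] \<beta> by auto
  define d where "d = min \<beta> (1 - \<beta>) / 2"
  have "d > 0" "2 * d \<le> \<beta>" "2 * d \<le> 1 - \<beta>" using \<beta> by (auto simp: d_def)
  then have d: "d > 0" "\<beta> - d > 0" "\<beta> + d < 1" using \<beta> by linarith+
  have hi: "h \<beta> \<le> max P1 P2"
    using quasi_convex[of "\<beta> - d" \<beta> "\<beta> + d"] P1[of "\<beta> - d"] P2[of "\<beta> + d"] d \<beta> by auto
  \<comment> \<open>The point \<open>(\<beta> + d / 2, \<beta> - d / 2)\<close> is the midpoint of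
    \<open>(\<beta> + d, \<beta>)\<close> and \<open>(\<beta>, \<beta> - d)\<close>; comparing them
    bounds \<open>h \<beta>\<close> from below.\<close>
  have "A * h (\<beta> + d / 2) + B * h (\<beta> - d / 2)
      \<le> max (A * h (\<beta> + d) + B * h \<beta>) (A * h \<beta> + B * h (\<beta> - d))"
    using qc_mid[of "\<beta> - d / 2" "d / 2" "\<beta> + d / 2" "d / 2"] d \<beta> by (auto simp: add.commute)
  then have "A * P2 + B * P1 \<le> max (A * P2 + B * h \<beta>) (A * h \<beta> + B * P1)"
    using P1[of "\<beta> - d"] P2[of "\<beta> + d"] P1[of "\<beta> - d / 2"] P2[of "\<beta> + d / 2"] d \<beta> by auto
  then have lo: "min P1 P2 \<le> h \<beta>" using A_pos B_pos by (auto simp: max_def split: if_splits)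
  show ?thesis by (rule that(3)[OF \<beta>(1,2) P1 P2 ends lo hi])
next
  case True
  then have cont: "\<And>x. 0 < x \<Longrightarrow> x < 1 \<Longrightarrow> isCont h x" by auto
  show ?thesis
  proof (cases "usc_at 0 \<and> usc_at 1")
    case True
    then show ?thesis by (intro that(1) convex_if_usc cont) auto
  next
    case False
    have "h x = h y" if xy: "0 < x" "x < y" "y < 1" for x y
    proof (cases "usc_at 1")
      case True
      interpret r: qc_triangle "\<lambda>x. h (1 - x)" B A C by (rule reflect)
      have "\<not> r.usc_at 1"
      proof
        assume r1: "r.usc_at 1"
        have "usc_at 0"
          unfolding usc_at_def
        proof (intro allI impI)
          fix e :: real assume "e > 0"
          then obtain d where "d > 0" and d: "\<forall>y\<in>{0..1}. \<bar>y - 1\<bar> < d \<longrightarrow> h (1 - y) \<le> h (1 - 1) + e"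
            using r1 unfolding r.usc_at_def by meson
          have "h y \<le> h 0 + e" if "y \<in> {0..1}" "\<bar>y - 0\<bar> < d" for y
            using d[rule_format, of "1 - y"] that by auto
          with \<open>d > 0\<close> show "\<exists>d>0. \<forall>y\<in>{0..1}. \<bar>y - 0\<bar> < d \<longrightarrow> h y \<le> h 0 + e" by blast
        qed
        with True False show False by simp
      qed
      then show ?thesis using r.not_usc_right_end_const[of "1 - y" "1 - x"] xy by auto
    next
      case False
      then show ?thesis using not_usc_right_end_const xy by blast
    qed
    then obtain P where "\<forall>x. 0 < x \<and> x < 1 \<longrightarrow> h x = P"
      using const_witness[of 0 1 h] by auto
    then have P: "\<And>x. 0 < x \<Longrightarrow> x < 1 \<Longrightarrow> h x = P" by simp
    moreover have "P \<le> max (h 0) (h 1)" using quasi_convex[of 0 "1/2" 1] P[of "1/2"] by auto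
    ultimately show ?thesis by (rule that(2))
  qed
qed

end

subsection \<open>The functional as a linear relation\<close>

text \<open>Below, \<open>f\<close> is \<open>h\<close> of a tail function and \<open>w = h 1\<close> its value near \<open>-\<infinity>\<close>.  Keeping \<open>w\<close> and the value
  \<open>q\<close> as arguments makes the relation linear, including integrability.\<close>

definition has_choquet :: "(real \<Rightarrow> real) \<Rightarrow> real \<Rightarrow> real \<Rightarrow> bool" where
  "has_choquet f w q \<longleftrightarrow> (\<exists>a b. has_bochner_integral lborel (\<lambda>x. indicator {0..} x * f x) a \<and>
     has_bochner_integral lborel (\<lambda>x. indicator {..0} x * (f x - w)) b \<and> q = a + b)"

abbreviation tail :: "real measure \<Rightarrow> real \<Rightarrow> real" where
  "tail F x \<equiv> measure F {x<..}"

lemma has_choquet_I_h: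
  assumes "has_choquet (\<lambda>x. h (tail F x)) (h 1) q"
  shows "I_h h F = q" "I_finite h F"
  using assms
  by (auto simp: has_choquet_def I_h_def I_finite_def set_lebesgue_integral_def set_integrable_def
      has_bochner_integral_iff)

lemma I_finite_has_choquet: "I_finite h F \<Longrightarrow> has_choquet (\<lambda>x. h (tail F x)) (h 1) (I_h h F)"
  by (auto simp: has_choquet_def I_h_def I_finite_def set_lebesgue_integral_def set_integrable_def
      has_bochner_integral_iff)

lemma has_choquet_add:
  assumes "has_choquet f w q" "has_choquet f' w' q'"
  shows "has_choquet (\<lambda>x. f x + f' x) (w + w') (q + q')"
proof -
  obtain a b a' b' where
    1: "has_bochner_integral lborel (\<lambda>x. indicator {0..} x * f x) a"
       "has_bochner_integral lborel (\<lambda>x. indicator {0..} x * f' x) a'"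
    and 2: "has_bochner_integral lborel (\<lambda>x. indicator {..0} x * (f x - w)) b"
       "has_bochner_integral lborel (\<lambda>x. indicator {..0} x * (f' x - w')) b'"
    and "q = a + b" "q' = a' + b'"
    using assms unfolding has_choquet_def by blast
  then have "q + q' = (a + a') + (b + b')" by simp
  with has_bochner_integral_add[OF 1] has_bochner_integral_add[OF 2] show ?thesis
    unfolding has_choquet_def by (auto simp: algebra_simps)
qed

lemma has_choquet_scale:
  assumes "has_choquet f w q"
  shows "has_choquet (\<lambda>x. c * f x) (c * w) (c * q)"
proof -
  obtain a b where
    1: "has_bochner_integral lborel (\<lambda>x. indicator {0..} x * f x) a"
    and 2: "has_bochner_integral lborel (\<lambda>x. indicator {..0} x * (f x - w)) b" and q: "q = a + b"
    using assms unfolding has_choquet_def by blast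
  have "has_bochner_integral lborel (\<lambda>x. indicator {0..} x * (c * f x)) (c * a)"
    using has_bochner_integral_mult_right[of c, OF 1] by (simp add: mult.left_commute)
  moreover have "has_bochner_integral lborel (\<lambda>x. indicator {..0} x * (c * f x - c * w)) (c * b)"
    using has_bochner_integral_mult_right[of c, OF 2] by (simp add: algebra_simps)
  ultimately show ?thesis
    unfolding has_choquet_def q by (auto simp: distrib_left)
qed

lemma has_choquet_mono:
  assumes "has_choquet f w q" "has_choquet f' w q'" "\<And>x. f x \<le> f' x"
  shows "q \<le> q'"
proof -
  obtain a b where
    "has_bochner_integral lborel (\<lambda>x. indicator {0..} x * f x) a"
    "has_bochner_integral lborel (\<lambda>x. indicator {..0} x * (f x - w)) b" "q = a + b"
    using assms unfolding has_choquet_def by blast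
  moreover obtain a' b' where
    "has_bochner_integral lborel (\<lambda>x. indicator {0..} x * f' x) a'"
    "has_bochner_integral lborel (\<lambda>x. indicator {..0} x * (f' x - w)) b'" "q' = a' + b'"
    using assms unfolding has_choquet_def by blast
  moreover have "integral\<^sup>L lborel (\<lambda>x. indicator {0..} x * f x) \<le> integral\<^sup>L lborel (\<lambda>x. indicator {0..} x * f' x)"
    "integral\<^sup>L lborel (\<lambda>x. indicator {..0} x * (f x - w)) \<le> integral\<^sup>L lborel (\<lambda>x. indicator {..0} x * (f' x - w))"
    using calculation assms(3) by (intro integral_mono mult_left_mono; auto simp: has_bochner_integral_iff)+
  ultimately show ?thesis by (auto simp: has_bochner_integral_iff)
qed

text \<open>The value at the jump is irrelevant, so this covers both one-sided versions of a quantile.\<close>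

lemma has_choquet_step:
  fixes f :: "real \<Rightarrow> real"
  assumes "\<And>x. x < q \<Longrightarrow> f x = 1" "\<And>x. q < x \<Longrightarrow> f x = 0"
  shows "has_choquet f 1 q"
proof -
  have ind: "has_bochner_integral lborel (indicator A :: real \<Rightarrow> real) (measure lborel A)"
    if "A \<in> sets borel" "emeasure lborel A < \<infinity>" for A :: "real set"
    using that by (intro has_bochner_integral_real_indicator) auto
  \<comment> \<open>The value at \<open>q\<close> enters as a multiple of the indicator of a
    singleton, which has integral 0.\<close>
  have "(\<lambda>x. indicator {0..} x * f x) = (\<lambda>x. indicator {0..<q} x + (indicator {0..} q * f q) * indicator {q} x)"
    using assms by (auto simp: fun_eq_iff indicator_def neq_iff)
  moreover have "has_bochner_integral lborel
      (\<lambda>x. indicator {0..<q} x + (indicator {0..} q * f q) * indicator {q} x)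
      (measure lborel {0..<q} + (indicator {0..} q * f q) * measure lborel {q})"
    by (intro has_bochner_integral_add has_bochner_integral_mult_right ind emeasure_bounded_finite) auto
  ultimately have 1: "has_bochner_integral lborel (\<lambda>x. indicator {0..} x * f x) (max 0 q)"
    by (cases "0 \<le> q") auto
  have "(\<lambda>x. indicator {..0} x * (f x - 1)) =
      (\<lambda>x. (- 1) * indicator {q<..0} x + (indicator {..0} q * (f q - 1)) * indicator {q} x)"
    using assms by (auto simp: fun_eq_iff indicator_def neq_iff)
  moreover have "has_bochner_integral lborel
      (\<lambda>x. (- 1) * indicator {q<..0} x + (indicator {..0} q * (f q - 1)) * indicator {q} x)
      ((- 1) * measure lborel {q<..0} + (indicator {..0} q * (f q - 1)) * measure lborel {q})"
    by (intro has_bochner_integral_add has_bochner_integral_mult_right ind emeasure_bounded_finite) auto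
  ultimately have 2: "has_bochner_integral lborel (\<lambda>x. indicator {..0} x * (f x - 1)) (min 0 q)"
    by (cases "q \<le> 0") auto
  show ?thesis unfolding has_choquet_def
    using 1 2 by (intro exI[of _ "min 0 q", THEN exI[of _ "max 0 q"]]) auto
qed

text \<open>\<open>f\<close> is a sum of steps of heights \<open>p - q\<close>, \<open>q - r\<close>
  and \<open>r\<close> that end at \<open>x\<close>, \<open>y\<close> and \<open>z\<close>.\<close>

lemma has_choquet_three_steps:
  fixes f :: "real \<Rightarrow> real"
  assumes "x < y" "y < z" and "\<And>u. u < x \<Longrightarrow> f u = p" "\<And>u. x \<le> u \<Longrightarrow> u < y \<Longrightarrow> f u = q"
    "\<And>u. y \<le> u \<Longrightarrow> u < z \<Longrightarrow> f u = r" "\<And>u. z \<le> u \<Longrightarrow> f u = 0"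
  shows "has_choquet f p (x * p + (y - x) * q + (z - y) * r)"
proof -
  have "has_choquet (\<lambda>u. (p - q) * indicator {..<x} u + (q - r) * indicator {..<y} u + r * indicator {..<z} u)
     ((p - q) * 1 + (q - r) * 1 + r * 1) ((p - q) * x + (q - r) * y + r * z)"
    by (intro has_choquet_add has_choquet_scale has_choquet_step) auto
  moreover have "(\<lambda>u. (p - q) * indicator {..<x} u + (q - r) * indicator {..<y} u + r * indicator {..<z} u) = f"
    using assms by (auto simp: fun_eq_iff indicator_def not_less)
  ultimately show ?thesis by (simp add: algebra_simps)
qed

lemma has_choquet_bounded:
  fixes f :: "real \<Rightarrow> real"
  assumes [measurable]: "f \<in> borel_measurable borel" and bound: "\<And>x. \<bar>f x\<bar> \<le> C"
    and "\<And>x. x < lo \<Longrightarrow> f x = w" "\<And>x. hi \<le> x \<Longrightarrow> f x = 0"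
  obtains q where "has_choquet f w q"
proof -
  have "integrable lborel (\<lambda>x. indicator {0..} x * f x)"
  proof (rule Bochner_Integration.integrable_bound)
    show "integrable lborel (\<lambda>x. C * indicator {0..hi} x)"
      by (intro integrable_mult_right integrable_real_indicator) (auto simp: emeasure_lborel_Icc_eq)
    show "AE x in lborel. norm (indicator {0..} x * f x) \<le> norm (C * indicator {0..hi} x)"
      using assms(4) bound by (auto simp: indicator_def intro: order_trans[OF bound abs_ge_self])
  qed auto
  moreover have "integrable lborel (\<lambda>x. indicator {..0} x * (f x - w))"
  proof (rule Bochner_Integration.integrable_bound)
    show "integrable lborel (\<lambda>x. (C + \<bar>w\<bar>) * indicator {lo..0} x)"
      by (intro integrable_mult_right integrable_real_indicator) (auto simp: emeasure_lborel_Icc_eq)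
    show "AE x in lborel. norm (indicator {..0} x * (f x - w)) \<le> norm ((C + \<bar>w\<bar>) * indicator {lo..0} x)"
    proof (rule AE_I2)
      fix x
      show "norm (indicator {..0} x * (f x - w)) \<le> norm ((C + \<bar>w\<bar>) * indicator {lo..0} x)"
        using bound[of x] assms(3)[of x] by (auto simp: indicator_def)
    qed
  qed auto
  ultimately show ?thesis
    using that unfolding has_choquet_def has_bochner_integral_iff by blast
qed

section \<open>Tails and quantiles\<close>

lemma tail_eq_cdf:
  assumes "real_distribution F" shows "tail F x = 1 - cdf F x"
proof -
  interpret real_distribution F by fact
  have "UNIV - {..x} = {x<..}" by auto
  then show ?thesis using prob_compl[of "{..x}"] by (simp add: cdf_def)
qed

lemma compactly_supported_tail:
  assumes "F \<in> compactly_supported_dists"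
  obtains lo hi where "\<And>x. x < lo \<Longrightarrow> tail F x = 1" "\<And>x. hi \<le> x \<Longrightarrow> tail F x = 0" "real_distribution F"
proof -
  interpret real_distribution F using assms by (simp add: compactly_supported_dists_def)
  obtain K where K: "compact K" "measure F K = 1" using assms by (auto simp: compactly_supported_dists_def)
  obtain b where b: "\<And>x. x \<in> K \<Longrightarrow> \<bar>x\<bar> \<le> b"
    using compact_imp_bounded[OF K(1)] by (auto simp: bounded_iff)
  have [measurable]: "K \<in> sets borel" using K(1) by (intro borel_closed compact_imp_closed)
  have one: "measure F A = 1" if "K \<subseteq> A" "A \<in> sets borel" for A
    using finite_measure_mono[of K A] that K prob_le_1[of A] by auto
  show ?thesis
  proof (rule that)
    fix x assume "x < - b"
    then show "tail F x = 1" using b by (intro one) force+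
  next
    fix x assume "b \<le> x"
    then have "measure F {..x} = 1" using b by (intro one) force+
    then show "tail F x = 0" using tail_eq_cdf[OF real_distribution_axioms] by (simp add: cdf_def)
  qed (fact real_distribution_axioms)
qed

text \<open>A quantile is the infimum of an upward closed set, and the indicator of the complement
  of this set is a step ending there, whichever value it takes at the infimum.\<close>

lemma has_choquet_Inf:
  assumes lo: "\<And>x. x < lo \<Longrightarrow> \<not> P x" and hi: "P hi" and up: "\<And>x y. P x \<Longrightarrow> x \<le> y \<Longrightarrow> P y"
  shows "has_choquet (\<lambda>x. of_bool (\<not> P x)) 1 (Inf {x. P x})"
proof (rule has_choquet_step)
  have bdd: "bdd_below {x. P x}" using lo by (intro bdd_belowI[of _ lo]) force
  show "of_bool (\<not> P x) = (1::real)" if "x < Inf {x. P x}" for x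
    using cInf_lower[OF _ bdd, of x] that by auto
  show "of_bool (\<not> P x) = (0::real)" if "Inf {x. P x} < x" for x
    using cInf_lessD[OF _ that] hi up by (auto dest: less_imp_le)
qed

text \<open>The distortion function of the quantile \<^term>\<open>Q_mix c \<alpha>\<close>; \<open>\<alpha> = 0\<close> and \<open>\<alpha> = 1\<close> give the
  essential infimum and supremum whatever \<open>c\<close> is.\<close>

definition quantile_distortion :: "real \<Rightarrow> real \<Rightarrow> real \<Rightarrow> real" where
  "quantile_distortion c \<alpha> t = (if \<alpha> = 0 then of_bool (1 \<le> t) else if \<alpha> = 1 then of_bool (0 < t)
     else c * of_bool (1 - \<alpha> \<le> t) + (1 - c) * of_bool (1 - \<alpha> < t))"

text \<open>\<open>of_bool (1 \<le> t)\<close> is the distortion function of the essential infimum,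
  \<open>of_bool (0 < t)\<close> that of the essential supremum.\<close>

definition qsm_distortion :: "real \<Rightarrow> real \<Rightarrow> real \<Rightarrow> real \<Rightarrow> real \<Rightarrow> real \<Rightarrow> real" where
  "qsm_distortion a b k c \<alpha> t = a * of_bool (1 \<le> t) + (- b) * of_bool (0 < t) + k * quantile_distortion c \<alpha> t"

lemma has_choquet_qsm:
  assumes F: "F \<in> compactly_supported_dists" and \<alpha>: "\<alpha> \<in> {0..1}"
  shows "has_choquet (\<lambda>x. qsm_distortion a b k c \<alpha> (tail F x)) (a - b + k) (S_ab a b F + k * Q_mix c \<alpha> F)"
proof -
  obtain lo hi where lo: "\<And>x. x < lo \<Longrightarrow> tail F x = 1" and hi: "\<And>x. hi \<le> x \<Longrightarrow> tail F x = 0"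
    and dist: "real_distribution F"
    using compactly_supported_tail[OF F] by blast
  interpret real_distribution F by fact
  note tail = tail_eq_cdf[OF dist]
  have cdf: "\<And>x. x < lo \<Longrightarrow> cdf F x = 0" "cdf F hi = 1" using lo hi[of hi] tail by auto
  have P: "has_choquet (\<lambda>x. of_bool (\<not> P (cdf F x))) 1 (Inf {x. P (cdf F x)})"
    if "\<not> P 0" "P 1" "\<And>u v. P u \<Longrightarrow> u \<le> v \<Longrightarrow> P v" for P
  proof (rule has_choquet_Inf[of lo _ hi])
    show "\<not> P (cdf F x)" if "x < lo" for x using cdf(1)[OF that] \<open>\<not> P 0\<close> by simp
    show "P (cdf F hi)" using cdf(2) \<open>P 1\<close> by simp
    show "P (cdf F y)" if "P (cdf F x)" "x \<le> y" for x y
      using \<open>\<And>u v. P u \<Longrightarrow> u \<le> v \<Longrightarrow> P v\<close>[OF that(1) cdf_nondecreasing[OF that(2)]] .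
  qed
  have Q0: "has_choquet (\<lambda>x. of_bool (1 \<le> tail F x)) 1 (Q0 F)"
    using P[of "\<lambda>u. u > 0"] by (simp add: Q0_def tail not_less)
  have Q1: "has_choquet (\<lambda>x. of_bool (0 < tail F x)) 1 (Q1 F)"
    using P[of "\<lambda>u. u \<ge> 1"] by (simp add: Q1_def tail not_le)
  have Q: "has_choquet (\<lambda>x. quantile_distortion c \<alpha> (tail F x)) 1 (Q_mix c \<alpha> F)"
  proof (cases "\<alpha> = 0 \<or> \<alpha> = 1")
    case True
    then show ?thesis using Q0 Q1
      by (auto simp: quantile_distortion_def Q_mix_def Q_plus_def Q_minus_def algebra_simps)
  next
    case False
    then have "0 < \<alpha>" "\<alpha> < 1" using \<alpha> by auto
    then have "has_choquet (\<lambda>x. of_bool (\<not> cdf F x > \<alpha>)) 1 (Inf {x. cdf F x > \<alpha>})"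
      "has_choquet (\<lambda>x. of_bool (\<not> cdf F x \<ge> \<alpha>)) 1 (Inf {x. cdf F x \<ge> \<alpha>})"
      by (auto intro!: P)
    \<comment> \<open>Complementing exchanges strict and weak inequalities, so the upper quantile
      belongs to the weak threshold for the tail.\<close>
    moreover have "\<not> cdf F x > \<alpha> \<longleftrightarrow> 1 - \<alpha> \<le> tail F x" "\<not> cdf F x \<ge> \<alpha> \<longleftrightarrow> 1 - \<alpha> < tail F x" for x
      using tail[of x] by linarith+
    ultimately have "has_choquet (\<lambda>x. of_bool (1 - \<alpha> \<le> tail F x)) 1 (Inf {x. cdf F x > \<alpha>})"
      "has_choquet (\<lambda>x. of_bool (1 - \<alpha> < tail F x)) 1 (Inf {x. cdf F x \<ge> \<alpha>})"
      by simp_all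
    then have "has_choquet (\<lambda>x. c * of_bool (1 - \<alpha> \<le> tail F x) + (1 - c) * of_bool (1 - \<alpha> < tail F x))
       (c * 1 + (1 - c) * 1) (c * Inf {x. cdf F x > \<alpha>} + (1 - c) * Inf {x. cdf F x \<ge> \<alpha>})"
      by (intro has_choquet_add has_choquet_scale)
    then show ?thesis using False by (simp add: quantile_distortion_def Q_mix_def Q_plus_def Q_minus_def)
  qed
  have "has_choquet (\<lambda>x. qsm_distortion a b k c \<alpha> (tail F x)) (a * 1 + (- b) * 1 + k * 1)
     (a * Q0 F + (- b) * Q1 F + k * Q_mix c \<alpha> F)"
    unfolding qsm_distortion_def by (intro has_choquet_add has_choquet_scale Q0 Q1 Q)
  then show ?thesis by (simp add: S_ab_def)
qed

lemma qsm_distortion_0: "\<alpha> \<in> {0..1} \<Longrightarrow> qsm_distortion a b k c \<alpha> 0 = 0"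
  by (auto simp: qsm_distortion_def quantile_distortion_def)

lemma qsm_distortion_1: "\<alpha> \<in> {0..1} \<Longrightarrow> qsm_distortion a b k c \<alpha> 1 = a - b + k"
  by (auto simp: qsm_distortion_def quantile_distortion_def)

subsection \<open>Three-point distributions\<close>

text \<open>A property, not a fixed term, so that it applies to mixtures however they are built.
  Once \<open>v x < v y < v z\<close>, the numbers \<open>s\<close> and \<open>t\<close> are the
  tail probabilities of the push-forward between consecutive values.\<close>

definition three_point :: "real \<Rightarrow> real \<Rightarrow> real \<Rightarrow> real \<Rightarrow> real \<Rightarrow> real measure \<Rightarrow> bool" where
  "three_point x y z s t F \<longleftrightarrow> sets F = sets borel \<and>
     (\<forall>A\<in>sets borel. measure F A = (1 - s) * indicator A x + (s - t) * indicator A y + t * indicator A z)"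

lemma measure_mixture:
  assumes "real_distribution F" "real_distribution G" "l \<in> {0..1}" "A \<in> sets borel"
  shows "measure (mixture l F G) A = l * measure F A + (1 - l) * measure G A"
proof -
  interpret F: real_distribution F by fact
  interpret G: real_distribution G by fact
  have "emeasure (mixture l F G) A = ennreal l * ennreal (measure F A) + ennreal (1 - l) * ennreal (measure G A)"
    using assms by (simp add: emeasure_mixture F.emeasure_eq_measure G.emeasure_eq_measure)
  also have "\<dots> = ennreal (l * measure F A + (1 - l) * measure G A)"
    using assms(3) by (simp add: ennreal_mult ennreal_plus)
  finally have "emeasure (mixture l F G) A = ennreal (l * measure F A + (1 - l) * measure G A)" .
  then show ?thesis
    using assms(3) unfolding measure_def[of "mixture l F G"] by (simp del: ennreal_plus add: enn2real_ennreal)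
qed

lemma real_distribution_return: "real_distribution (return borel x)"
  by (intro real_distribution.intro prob_space_return real_distribution_axioms.intro) auto

lemma three_point_exists:
  assumes "convex_dists M" "return borel x \<in> M" "return borel y \<in> M" "return borel z \<in> M"
    "0 \<le> t" "t \<le> s" "s \<le> 1"
  shows "\<exists>F\<in>M. three_point x y z s t F"
proof (intro bexI)
  let ?F = "mixture (1 - s) (return borel x) (mixture (1 - t / s) (return borel y) (return borel z))"
  \<comment> \<open>If \<open>s = 0\<close> then also \<open>t = 0\<close>, and \<open>t / s\<close>
    is 0 by the convention for division.\<close>
  have ts: "t / s \<le> 1" "0 \<le> t / s" "s * (t / s) = t" using assms by (auto simp: divide_le_eq_1)
  show "?F \<in> M" using assms ts by (auto simp: convex_dists_def)
  have "measure ?F A = (1 - s) * indicator A x + s * ((1 - t / s) * indicator A y + t / s * indicator A z)"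
    if "A \<in> sets borel" for A
    using that assms ts by (simp add: measure_mixture real_distribution_mixture real_distribution_return measure_return)
  moreover have "s * ((1 - t / s) * p + t / s * q) = (s - s * (t / s)) * p + s * (t / s) * q" for p q
    unfolding distrib_left left_diff_distrib right_diff_distrib by (simp only: mult.assoc mult_1_left)
  ultimately show "three_point x y z s t ?F"
    unfolding ts(3) by (simp add: three_point_def add.assoc)
qed

lemma three_point_mixture:
  assumes "real_distribution F" "real_distribution G" "l \<in> {0..1}"
    "three_point x y z s t F" "three_point x y z s' t' G"
  shows "three_point x y z (l * s + (1 - l) * s') (l * t + (1 - l) * t') (mixture l F G)"
proof -
  have "measure (mixture l F G) A = l * ((1 - s) * indicator A x + (s - t) * indicator A y + t * indicator A z)
      + (1 - l) * ((1 - s') * indicator A x + (s' - t') * indicator A y + t' * indicator A z)"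
    if "A \<in> sets borel" for A
    using assms that by (simp add: measure_mixture three_point_def)
  then show ?thesis by (simp add: three_point_def) (simp add: algebra_simps)
qed

lemma measure_distr_real:
  assumes "sets F = sets borel" "v \<in> borel_measurable borel" "A \<in> sets borel"
  shows "measure (distr F borel v) A = measure F (v -` A)"
proof -
  have "v \<in> measurable F borel" using assms by (simp cong: measurable_cong_sets)
  then show ?thesis using assms sets_eq_imp_space_eq[OF assms(1)] by (simp add: measure_distr)
qed

text \<open>The tail of the push-forward takes the values 1, \<open>s\<close>, \<open>t\<close>, 0
  on the intervals cut out by \<open>v x\<close>, \<open>v y\<close>, \<open>v z\<close>.\<close>

lemma three_point_R_hv:
  assumes F: "three_point x y z s t F" and v: "v \<in> borel_measurable borel" "v x < v y" "v y < v z"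
    and "h 0 = 0"
  shows "R_hv h v F = v x * h 1 + (v y - v x) * h s + (v z - v y) * h t"
proof -
  have "tail (distr F borel v) u = (1 - s) * indicator {u<..} (v x) + (s - t) * indicator {u<..} (v y)
      + t * indicator {u<..} (v z)" for u
    using F v measurable_sets[OF v(1), of "{u<..}"]
    by (simp add: measure_distr_real three_point_def indicator_def)
  then have "has_choquet (\<lambda>u. h (tail (distr F borel v) u)) (h 1)
      (v x * h 1 + (v y - v x) * h s + (v z - v y) * h t)"
    using v \<open>h 0 = 0\<close> by (intro has_choquet_three_steps) (auto simp: indicator_def)
  then show ?thesis unfolding R_hv_def by (rule has_choquet_I_h)
qed

lemma R_hv_id:
  assumes "sets F = sets borel" shows "R_hv h (\<lambda>x. x) F = I_h h F"
  using assms by (simp add: R_hv_def I_h_def measure_distr_real)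

lemma H_BV_bounded:
  assumes "h \<in> H_BV"
  obtains C where "\<And>x. 0 \<le> x \<Longrightarrow> x \<le> 1 \<Longrightarrow> \<bar>h x\<bar> \<le> C"
proof -
  obtain B where B: "\<And>n (t :: nat \<Rightarrow> real). mono_on {..n} t \<Longrightarrow> t ` {..n} \<subseteq> {0..1} \<Longrightarrow>
        (\<Sum>i<n. \<bar>h (t (Suc i)) - h (t i)\<bar>) \<le> B" and h0: "h 0 = 0"
    using assms unfolding H_BV_def bounded_variation_on_def by blast
  show ?thesis
  proof (rule that)
    fix x :: real assume x: "0 \<le> x" "x \<le> 1"
    show "\<bar>h x\<bar> \<le> B"
      using B[of 1 "\<lambda>i. if i = 0 then 0 else x"] x h0 by (auto simp: mono_on_def image_subset_iff)
  qed
qed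

text \<open>Bernoulli distributions recover \<open>h t\<close> from the functional, so the quantile
  representation on compactly supported distributions becomes a pointwise formula for
  \<open>h\<close>. In this form it applies to every push-forward.\<close>

lemma H_QSM_iff:
  assumes "h \<in> H_BV"
  shows "h \<in> H_QSM \<longleftrightarrow> (\<exists>a b \<alpha> c k. a \<ge> 0 \<and> b \<ge> 0 \<and> \<alpha> \<in> {0..1} \<and> c \<in> {0..1} \<and>
     (\<forall>t\<in>{0..1}. h t = qsm_distortion a b k c \<alpha> t))" (is "_ \<longleftrightarrow> ?R")
proof
  assume "h \<in> H_QSM"
  then obtain a b \<alpha> c k where p: "a \<ge> 0" "b \<ge> 0" "\<alpha> \<in> {0..1}" "c \<in> {0..1}"
    and eq: "\<And>F. F \<in> compactly_supported_dists \<Longrightarrow> I_h h F = S_ab a b F + k * Q_mix c \<alpha> F"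
    unfolding H_QSM_def mem_Collect_eq by blast
  have "h t = qsm_distortion a b k c \<alpha> t" if t: "t \<in> {0..1}" for t
  proof -
    let ?F = "mixture (1 - t) (return borel (0::real)) (return borel 1)"
    have dist: "real_distribution ?F"
      using t by (intro real_distribution_mixture real_distribution_return) auto
    \<comment> \<open>The point 2 is a dummy of mass 0.\<close>
    have F: "three_point 0 1 2 t 0 ?F"
      using t by (auto simp: three_point_def measure_mixture real_distribution_return measure_return)
    have "measure ?F {0, 1} = 1" using F by (simp add: three_point_def)
    then have cs: "?F \<in> compactly_supported_dists"
      using dist by (auto simp: compactly_supported_dists_def intro!: exI[of _ "{0, 1}"])
    have val: "I_h g ?F = g t" if "g 0 = 0" for g
      using three_point_R_hv[OF F, of "\<lambda>x. x" g] that by (simp add: R_hv_id)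
    have "I_h (qsm_distortion a b k c \<alpha>) ?F = S_ab a b ?F + k * Q_mix c \<alpha> ?F"
      using has_choquet_I_h(1)[of "qsm_distortion a b k c \<alpha>"] has_choquet_qsm[OF cs p(3)]
        qsm_distortion_1[OF p(3)] by metis
    also have "\<dots> = I_h h ?F" using eq[OF cs] by simp
    finally show ?thesis
      using val[of h] val[of "qsm_distortion a b k c \<alpha>"] assms qsm_distortion_0[OF p(3)]
      by (simp add: H_BV_def)
  qed
  with p show ?R by blast
next
  assume ?R
  then obtain a b \<alpha> c k where p: "a \<ge> 0" "b \<ge> 0" "\<alpha> \<in> {0..1}" "c \<in> {0..1}"
    and eq: "\<And>t. t \<in> {0..1} \<Longrightarrow> h t = qsm_distortion a b k c \<alpha> t" by blast
  have "I_h h F = S_ab a b F + k * Q_mix c \<alpha> F" if F: "F \<in> compactly_supported_dists" for F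
  proof -
    interpret real_distribution F using F by (simp add: compactly_supported_dists_def)
    have "has_choquet (\<lambda>x. h (tail F x)) (h 1) (S_ab a b F + k * Q_mix c \<alpha> F)"
      using has_choquet_qsm[OF F p(3)] qsm_distortion_1[OF p(3)] eq by simp
    then show ?thesis by (rule has_choquet_I_h)
  qed
  with p assms show "h \<in> H_QSM" unfolding H_QSM_def by blast
qed

subsection \<open>The equivalences\<close>

text \<open>If the mixture \<open>T\<close> exceeded \<open>T1\<close> at \<open>x\<close> and
  \<open>T2\<close> at \<open>y\<close> after applying \<open>e\<close>, both comparisons would
  cross \<beta>. Then \<open>T1 x \<le> \<beta> \<le> T y < T1 y\<close> gives \<open>y < x\<close>,
  and \<open>T2 y \<le> \<beta> \<le> T x < T2 x\<close> gives \<open>x < y\<close>. The reverse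
  inequalities are handled alike.\<close>

lemma mixed_tail_comparison:
  fixes e :: "real \<Rightarrow> real" and T1 T2 :: "real \<Rightarrow> real"
  assumes e: "mono e" "\<And>u v. e u < e v \<Longrightarrow> u \<le> \<beta> \<and> \<beta> \<le> v"
    and T: "antimono T1" "antimono T2" and l: "l \<in> {0..1}"
  shows "(\<forall>x. e (l * T1 x + (1 - l) * T2 x) \<le> e (T1 x)) \<or> (\<forall>x. e (l * T1 x + (1 - l) * T2 x) \<le> e (T2 x))"
    and "(\<forall>x. e (T1 x) \<le> e (l * T1 x + (1 - l) * T2 x)) \<or> (\<forall>x. e (T2 x) \<le> e (l * T1 x + (1 - l) * T2 x))"
proof -
  define T where "T x = l * T1 x + (1 - l) * T2 x" for x
  have less: "u < w" if "e u < e w" for u w using that e(1) by (meson leD leI monoD)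
  have "((\<forall>x. e (T x) \<le> e (T1 x)) \<or> (\<forall>x. e (T x) \<le> e (T2 x))) \<and>
    ((\<forall>x. e (T1 x) \<le> e (T x)) \<or> (\<forall>x. e (T2 x) \<le> e (T x)))"
  proof (cases "l = 0 \<or> l = 1")
    case True
    then show ?thesis by (auto simp: T_def)
  next
    case False
    then have l: "0 < l" "l < 1" using l by auto
    have pos: "(1 - l) * d > 0 \<longleftrightarrow> d > 0" "l * d > 0 \<longleftrightarrow> d > 0" for d
      using l by (simp_all add: zero_less_mult_iff)
    have d: "T x - T1 x = (1 - l) * (T2 x - T1 x)" "T2 x - T x = l * (T2 x - T1 x)"
      "T1 x - T x = (1 - l) * (T1 x - T2 x)" "T x - T2 x = l * (T1 x - T2 x)" for x
      by (simp_all add: T_def algebra_simps)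
    have iff: "T1 x < T x \<longleftrightarrow> T x < T2 x" "T x < T1 x \<longleftrightarrow> T2 x < T x" for x
      using d[of x] pos by (metis diff_gt_0_iff_gt)+
    have ord: "y < x" if "T1 x < T1 y \<or> T2 x < T2 y" for x y
      using that antimonoD[OF T(1), of x y] antimonoD[OF T(2), of x y] by linarith
    have False if xy: "e (T1 x) < e (T x)" "e (T2 y) < e (T y)" for x y
      using e(2)[OF xy(1)] e(2)[OF xy(2)] iff[of x] iff[of y] less[OF xy(1)] less[OF xy(2)]
        ord[of x y] ord[of y x] by linarith
    moreover have False if xy: "e (T x) < e (T1 x)" "e (T y) < e (T2 y)" for x y
      using e(2)[OF xy(1)] e(2)[OF xy(2)] iff[of x] iff[of y] less[OF xy(1)] less[OF xy(2)]
        ord[of x y] ord[of y x] by linarith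
    ultimately show ?thesis by (meson not_le)
  qed
  then show "(\<forall>x. e (l * T1 x + (1 - l) * T2 x) \<le> e (T1 x)) \<or> (\<forall>x. e (l * T1 x + (1 - l) * T2 x) \<le> e (T2 x))"
    "(\<forall>x. e (T1 x) \<le> e (l * T1 x + (1 - l) * T2 x)) \<or> (\<forall>x. e (T2 x) \<le> e (l * T1 x + (1 - l) * T2 x))"
    unfolding T_def by auto
qed

text \<open>The quantile term selects the dominating component. The two extremal terms are dominated
  by either component: the mixed tail reaches 1 or 0 only where both tails do.\<close>

lemma qsm_distortion_mixed_tails:
  fixes T1 T2 :: "real \<Rightarrow> real"
  assumes T: "antimono T1" "antimono T2" "range T1 \<subseteq> {0..1}" "range T2 \<subseteq> {0..1}"
    and l: "l \<in> {0..1}" and p: "a \<ge> 0" "b \<ge> 0" "\<alpha> \<in> {0..1}" "c \<in> {0..1}"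
  shows "\<exists>S\<in>{T1, T2}. \<forall>x. qsm_distortion a b k c \<alpha> (l * T1 x + (1 - l) * T2 x) \<le> qsm_distortion a b k c \<alpha> (S x)"
proof (cases "l = 0 \<or> l = 1")
  case True
  then show ?thesis by auto
next
  case False
  then have l01: "0 < l" "l < 1" using l by auto
  define T where "T x = l * T1 x + (1 - l) * T2 x" for x
  define e where "e = quantile_distortion c \<alpha>"
  have "mono e"
    using p by (auto simp: e_def mono_def quantile_distortion_def)
  moreover have "u \<le> 1 - \<alpha> \<and> 1 - \<alpha> \<le> v" if "e u < e v" for u v
    using that p by (auto simp: e_def quantile_distortion_def of_bool_def split: if_splits)
  ultimately have "(\<forall>x. e (T x) \<le> e (T1 x)) \<or> (\<forall>x. e (T x) \<le> e (T2 x))"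
    "(\<forall>x. e (T1 x) \<le> e (T x)) \<or> (\<forall>x. e (T2 x) \<le> e (T x))"
    unfolding T_def using mixed_tail_comparison[of e "1 - \<alpha>" T1 T2 l] T l by blast+
  \<comment> \<open>The sign of \<open>k\<close> decides which of the two alternatives is
    used.\<close>
  then have "\<exists>S\<in>{T1, T2}. \<forall>x. k * e (T x) \<le> k * e (S x)"
    by (cases "k \<ge> 0") (auto intro: mult_left_mono mult_left_mono_neg)
  moreover have "a * of_bool (1 \<le> T x) + (- b) * of_bool (0 < T x) \<le> a * of_bool (1 \<le> S x) + (- b) * of_bool (0 < S x)"
    if "S \<in> {T1, T2}" for S x
  proof -
    have r: "0 \<le> T1 x" "T1 x \<le> 1" "0 \<le> T2 x" "T2 x \<le> 1" using T by (auto simp: image_subset_iff)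
    have "T x \<ge> 1 \<longrightarrow> T1 x = 1 \<and> T2 x = 1"
    proof
      assume "T x \<ge> 1"
      moreover have "1 - T x = l * (1 - T1 x) + (1 - l) * (1 - T2 x)"
        by (simp add: T_def algebra_simps)
      moreover have "l * (1 - T1 x) \<ge> 0" "(1 - l) * (1 - T2 x) \<ge> 0" using r l01 by auto
      ultimately have "l * (1 - T1 x) = 0" "(1 - l) * (1 - T2 x) = 0" by linarith+
      then show "T1 x = 1 \<and> T2 x = 1" using l01 by simp
    qed
    moreover have "T x \<le> 0 \<longrightarrow> T1 x = 0 \<and> T2 x = 0"
    proof
      assume "T x \<le> 0"
      moreover have "l * T1 x \<ge> 0" "(1 - l) * T2 x \<ge> 0" using r l01 by auto
      ultimately have "l * T1 x = 0" "(1 - l) * T2 x = 0" unfolding T_def by linarith+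
      then show "T1 x = 0 \<and> T2 x = 0" using l01 by simp
    qed
    ultimately show ?thesis using that p r by (auto simp: of_bool_def)
  qed
  ultimately show ?thesis
    unfolding qsm_distortion_def T_def[symmetric] e_def[symmetric] by (meson add_mono)
qed

lemma tail_distr_mixture:
  assumes "real_distribution F" "real_distribution G" "l \<in> {0..1}" "v \<in> borel_measurable borel"
  shows "tail (distr (mixture l F G) borel v) x
    = l * tail (distr F borel v) x + (1 - l) * tail (distr G borel v) x"
proof -
  have "v -` {x<..} \<in> sets borel" using measurable_sets[OF assms(4), of "{x<..}"] by simp
  moreover have "sets F = sets borel" "sets G = sets borel"
    using assms by (auto simp: real_distribution_def real_distribution_axioms_def)
  ultimately show ?thesis using assms by (simp add: measure_distr_real measure_mixture)
qed

lemma tail_antimono_range: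
  assumes "real_distribution F" shows "antimono (tail F)" "range (tail F) \<subseteq> {0..1}"
proof -
  interpret real_distribution F by fact
  show "antimono (tail F)" by (auto simp: antimono_def intro!: finite_measure_mono)
  show "range (tail F) \<subseteq> {0..1}" by auto
qed

lemma H_BV_0: "h \<in> H_BV \<Longrightarrow> h 0 = 0" by (simp add: H_BV_def)

section \<open>Necessity: the shape of \<open>h\<close>\<close>

text \<open>Mixing three-point distributions is affine in \<open>(s, t)\<close>, and the term
  \<open>v x * h 1\<close> common to all of them cancels.\<close>

lemma qc_triangle_of_p_quasi_convex:
  assumes M: "M \<subseteq> compactly_supported_dists" "convex_dists M"
    and h: "h 0 = 0" "\<And>u. 0 \<le> u \<Longrightarrow> u \<le> 1 \<Longrightarrow> \<bar>h u\<bar> \<le> C"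
    and v: "v \<in> borel_measurable borel" "v x < v y" "v y < v z"
    and pts: "return borel x \<in> M" "return borel y \<in> M" "return borel z \<in> M"
    and qc: "p_quasi_convex_on M (R_hv h v)"
  shows "qc_triangle h (v y - v x) (v z - v y) C"
proof
  fix s t s' t' l :: real
  assume *: "0 \<le> t" "t \<le> s" "s \<le> 1" "0 \<le> t'" "t' \<le> s'" "s' \<le> 1" "0 \<le> l" "l \<le> 1"
  obtain F where F: "F \<in> M" "three_point x y z s t F"
    using three_point_exists[OF M(2) pts] * by blast
  obtain G where G: "G \<in> M" "three_point x y z s' t' G"
    using three_point_exists[OF M(2) pts] * by blast
  have "real_distribution F" "real_distribution G"
    using M F G by (auto simp: compactly_supported_dists_def)
  then have FG: "three_point x y z (l * s + (1 - l) * s') (l * t + (1 - l) * t') (mixture l F G)"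
    using F G * by (intro three_point_mixture) auto
  have "R_hv h v (mixture l F G) \<le> max (R_hv h v F) (R_hv h v G)"
    using qc F G * by (auto simp: p_quasi_convex_on_def)
  then show "(v y - v x) * h (l * s + (1 - l) * s') + (v z - v y) * h (l * t + (1 - l) * t')
      \<le> max ((v y - v x) * h s + (v z - v y) * h t) ((v y - v x) * h s' + (v z - v y) * h t')"
    using three_point_R_hv[of x y z _ _ _ v h] F(2) G(2) FG v h(1) by (simp add: max_def split: if_splits)
qed (use v h in auto)

lemma distinct_sorted:
  fixes v :: "'a \<Rightarrow> real"
  assumes "distinct [v x, v y, v z]" "P x" "P y" "P z"
  obtains x y z where "v x < v y" "v y < v z" "P x" "P y" "P z"
  using assms by (cases "v x" "v y" rule: linorder_cases; cases "v y" "v z" rule: linorder_cases;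
      cases "v x" "v z" rule: linorder_cases) auto

lemma CX_or_QSM_of_p_quasi_convex:
  assumes M: "M \<subseteq> compactly_supported_dists" "convex_dists M" and h: "h \<in> H_BV"
    and v: "v \<in> V_M M" and qc: "p_quasi_convex_on M (R_hv h v)"
  shows "h \<in> H_CX \<union> H_QSM"
proof -
  have h0: "h 0 = 0" using h by (simp add: H_BV_def)
  obtain C where C: "\<And>u. 0 \<le> u \<Longrightarrow> u \<le> 1 \<Longrightarrow> \<bar>h u\<bar> \<le> C" using H_BV_bounded[OF h] by blast
  obtain x y z where "v x < v y" "v y < v z"
      "return borel x \<in> M" "return borel y \<in> M" "return borel z \<in> M"
    using v distinct_sorted[of v _ _ _ "\<lambda>x. return borel x \<in> M"] unfolding V_M_def by blast
  then interpret qc_triangle h "v y - v x" "v z - v y" C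
    using v qc_triangle_of_p_quasi_convex[OF M h0 C _ _ _ _ _ _ qc] by (auto simp: V_M_def)
  have qsm: "h \<in> H_QSM" if "a \<ge> 0" "b \<ge> 0" "\<alpha> \<in> {0..1}" "c \<in> {0..1}"
    "\<And>t. t \<in> {0<..<1} \<Longrightarrow> h t = qsm_distortion a b k c \<alpha> t" "h 1 = a - b + k" for a b \<alpha> c k
  proof -
    have "h t = qsm_distortion a b k c \<alpha> t" if "t \<in> {0..1}" for t
      using \<open>\<And>t. t \<in> {0<..<1} \<Longrightarrow> _ t\<close>[of t] that h0 \<open>h 1 = _\<close> \<open>\<alpha> \<in> _\<close>
      by (cases "t = 0 \<or> t = 1") (auto simp: qsm_distortion_0 qsm_distortion_1)
    then show ?thesis using that unfolding H_QSM_iff[OF h] by blast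
  qed
  show ?thesis
  proof (rule convex_or_step)
    assume "convex_on {0..1} h"
    then show ?thesis using h by (simp add: H_CX_def)
  next
    fix P assume P: "\<And>x. 0 < x \<Longrightarrow> x < 1 \<Longrightarrow> h x = P" "P \<le> max (h 0) (h 1)"
    show ?thesis
    proof (cases "P \<le> 0")
      case True
      \<comment> \<open>The jump at 0 is \<open>P = - b\<close>; the jump at 1, of either sign, is
        carried by \<open>k\<close> through the essential infimum, \<alpha> = 0.\<close>
      have "h \<in> H_QSM"
        by (rule qsm[of 0 "- P" 0 0 "h 1 - P"])
           (use True P in \<open>auto simp: qsm_distortion_def quantile_distortion_def\<close>)
      then show ?thesis by simp
    next
      case False
      \<comment> \<open>Now \<open>0 < P \<le> h 1\<close>: the jump at 0 is carried by
        \<open>k\<close> through the essential supremum, \<alpha> = 1, and the one at 1 is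
        \<open>a\<close>.\<close>
      have "h \<in> H_QSM"
        by (rule qsm[of "h 1 - P" 0 1 0 P])
           (use False P h0 in \<open>auto simp: qsm_distortion_def quantile_distortion_def\<close>)
      then show ?thesis by simp
    qed
  next
    fix \<beta> P1 P2
    assume \<beta>: "0 < \<beta>" "\<beta> < 1" and P: "\<And>x. 0 < x \<Longrightarrow> x < \<beta> \<Longrightarrow> h x = P1"
      "\<And>x. \<beta> < x \<Longrightarrow> x < 1 \<Longrightarrow> h x = P2" "P1 \<le> h 0" "P2 \<le> h 1"
      and mid: "min P1 P2 \<le> h \<beta>" "h \<beta> \<le> max P1 P2"
    \<comment> \<open>The relative height of \<open>h \<beta>\<close> between the two plateaus. If
      \<open>P1 = P2\<close> this is 0 by the convention for division, and
      \<open>h \<beta> = P1\<close>.\<close>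
    define c where "c = (h \<beta> - P1) / (P2 - P1)"
    have c: "c \<in> {0..1}" "h \<beta> = P1 + (P2 - P1) * c"
      using mid by (cases P1 P2 rule: linorder_cases; simp add: c_def divide_le_eq zero_le_divide_iff)+
    have "h \<in> H_QSM"
    \<comment> \<open>The jumps at 0, \<beta> and 1 are \<open>- b\<close>, \<open>k\<close> and
      \<open>a\<close>; the level is \<open>1 - \<beta>\<close> because \<open>h\<close> acts on
      tails.\<close>
    proof (rule qsm[of "h 1 - P2" "- P1" "1 - \<beta>" c "P2 - P1"])
      fix t :: real assume t: "t \<in> {0<..<1}"
      show "h t = qsm_distortion (h 1 - P2) (- P1) (P2 - P1) c (1 - \<beta>) t"
        using t P(1)[of t] P(2)[of t] c \<beta>
        by (cases t \<beta> rule: linorder_cases)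
           (auto simp: qsm_distortion_def quantile_distortion_def algebra_simps)
    qed (use \<beta> P c h0 in auto)
    then show ?thesis by simp
  qed
qed

section \<open>Sufficiency and finiteness\<close>

text \<open>The mixture also lies in \<open>M\<close>, so all three values come from finite
  integrals and pointwise inequalities between distorted tails pass to them by monotonicity.\<close>

lemma R_hv_p_quasi_convex:
  assumes M: "M \<subseteq> compactly_supported_dists" "convex_dists M" and h: "h \<in> H_BV" "h \<in> H_CX \<union> H_QSM"
    and v: "v \<in> borel_measurable borel" and fin: "R_real_valued_on M h v"
  shows "p_quasi_convex_on M (R_hv h v)"
  unfolding p_quasi_convex_on_def
proof (intro ballI)
  fix F G l assume FG: "F \<in> M" "G \<in> M" and l: "l \<in> {0..1::real}"
  let ?H = "mixture l F G"
  have dist: "real_distribution F" "real_distribution G"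
    using M FG by (auto simp: compactly_supported_dists_def)
  define T1 T2 where "T1 = tail (distr F borel v)" and "T2 = tail (distr G borel v)"
  have distr: "real_distribution (distr F borel v)" "real_distribution (distr G borel v)"
    using dist v by (auto intro!: prob_space.real_distribution_distr real_distribution.axioms(1)
        real_distribution.measurable_finite_borel)
  have T: "antimono T1" "antimono T2" "range T1 \<subseteq> {0..1}" "range T2 \<subseteq> {0..1}"
    unfolding T1_def T2_def using tail_antimono_range distr by auto
  have "?H \<in> M" using M(2) FG l by (simp add: convex_dists_def)
  then have fin: "I_finite h (distr F borel v)" "I_finite h (distr G borel v)" "I_finite h (distr ?H borel v)"
    using fin FG by (auto simp: R_real_valued_on_def)
  have IF: "has_choquet (\<lambda>x. h (T1 x)) (h 1) (R_hv h v F)"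
    using I_finite_has_choquet[OF fin(1)] by (simp add: R_hv_def T1_def)
  have IG: "has_choquet (\<lambda>x. h (T2 x)) (h 1) (R_hv h v G)"
    using I_finite_has_choquet[OF fin(2)] by (simp add: R_hv_def T2_def)
  have IH: "has_choquet (\<lambda>x. h (l * T1 x + (1 - l) * T2 x)) (h 1) (R_hv h v ?H)"
    using I_finite_has_choquet[OF fin(3)] tail_distr_mixture[OF dist l v]
    by (simp add: R_hv_def T1_def T2_def)
  have in01: "T1 x \<in> {0..1}" "T2 x \<in> {0..1}" "l * T1 x + (1 - l) * T2 x \<in> {0..1}" for x
  proof -
    show 1: "T1 x \<in> {0..1}" "T2 x \<in> {0..1}" using T(3,4) unfolding image_subset_iff by blast+
    show "l * T1 x + (1 - l) * T2 x \<in> {0..1}"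
      using convexD[of "{0..1::real}" "T1 x" "T2 x" l "1 - l"] 1 l by auto
  qed
  show "R_hv h v ?H \<le> max (R_hv h v F) (R_hv h v G)"
  proof (cases "h \<in> H_CX")
    case True
    then have "h (l * T1 x + (1 - l) * T2 x) \<le> l * h (T1 x) + (1 - l) * h (T2 x)" for x
      using convex_onD[of "{0..1}" h "1 - l" "T1 x" "T2 x"] in01[of x] l by (simp add: H_CX_def)
    moreover have "has_choquet (\<lambda>x. l * h (T1 x) + (1 - l) * h (T2 x)) (h 1)
        (l * R_hv h v F + (1 - l) * R_hv h v G)"
      using has_choquet_add[OF has_choquet_scale[OF IF, of l] has_choquet_scale[OF IG, of "1 - l"]]
      by (simp add: algebra_simps)
    ultimately have "R_hv h v ?H \<le> l * R_hv h v F + (1 - l) * R_hv h v G"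
      using IH has_choquet_mono by blast
    also have "\<dots> \<le> max (R_hv h v F) (R_hv h v G)"
      using l by (intro convex_bound_le) auto
    finally show ?thesis .
  next
    case False
    then obtain a b \<alpha> c k where p: "a \<ge> 0" "b \<ge> 0" "\<alpha> \<in> {0..1}" "c \<in> {0..1}"
      and eq: "\<And>t. t \<in> {0..1} \<Longrightarrow> h t = qsm_distortion a b k c \<alpha> t"
      using h H_QSM_iff[OF h(1)] by blast
    obtain S where S: "S \<in> {T1, T2}"
      "\<And>x. qsm_distortion a b k c \<alpha> (l * T1 x + (1 - l) * T2 x) \<le> qsm_distortion a b k c \<alpha> (S x)"
      using qsm_distortion_mixed_tails[OF T l p, of k] by blast
    then have "h (l * T1 x + (1 - l) * T2 x) \<le> h (S x)" for x
      using eq in01[of x] by auto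
    then show ?thesis
      using S(1) has_choquet_mono[OF IH IF] has_choquet_mono[OF IH IG] by (auto simp: le_max_iff_disj)
  qed
qed

text \<open>In the convex case the point is measurability: the tail is monotone and \<open>h\<close>
  quasi-convex, so sublevel sets of their composition are intervals. In the other case the quantile
  formula supplies the integrals.\<close>

lemma I_finite_compactly_supported:
  assumes h: "h \<in> H_BV" "h \<in> H_CX \<union> H_QSM" and F: "F \<in> compactly_supported_dists"
  shows "I_finite h F"
proof -
  obtain lo hi where lo: "\<And>x. x < lo \<Longrightarrow> tail F x = 1" and hi: "\<And>x. hi \<le> x \<Longrightarrow> tail F x = 0"
    and dist: "real_distribution F"
    using compactly_supported_tail[OF F] by blast
  have in01: "tail F x \<in> {0..1}" for x
    using tail_antimono_range(2)[OF dist] unfolding image_subset_iff by blast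
  show ?thesis
  proof (cases "h \<in> H_CX")
    case True
    obtain C where C: "\<And>u. 0 \<le> u \<Longrightarrow> u \<le> 1 \<Longrightarrow> \<bar>h u\<bar> \<le> C" using H_BV_bounded[OF h(1)] by blast
    have "is_interval {x. h (tail F x) \<le> r}" for r
      unfolding is_interval_1
    proof (intro ballI allI impI)
      fix x y m assume xy: "x \<in> {x. h (tail F x) \<le> r}" "y \<in> {x. h (tail F x) \<le> r}" "x \<le> m \<and> m \<le> y"
      then have "tail F y \<le> tail F m" "tail F m \<le> tail F x"
        using tail_antimono_range(1)[OF dist] by (auto simp: antimono_def)
      moreover have "convex_on {tail F y..tail F x} h"
        using True in01[of x] in01[of y] by (auto simp: H_CX_def elim!: convex_on_subset intro: order_trans[OF measure_nonneg])
      ultimately have "h (tail F m) \<le> max (h (tail F y)) (h (tail F x))"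
        by (intro convex_on_le_max) auto
      then show "m \<in> {x. h (tail F x) \<le> r}" using xy by auto
    qed
    then have "(\<lambda>x. h (tail F x)) \<in> borel_measurable borel"
      unfolding borel_measurable_iff_le by (auto intro: real_interval_borel_measurable)
    then obtain q where "has_choquet (\<lambda>x. h (tail F x)) (h 1) q"
      by (rule has_choquet_bounded[of _ C lo "h 1" hi]) (use C in01 lo hi H_BV_0[OF h(1)] in auto)
    then show ?thesis by (rule has_choquet_I_h)
  next
    case False
    then obtain a b \<alpha> c k where p: "\<alpha> \<in> {0..1}"
      and eq: "\<And>t. t \<in> {0..1} \<Longrightarrow> h t = qsm_distortion a b k c \<alpha> t"
      using h H_QSM_iff[OF h(1)] by blast
    then have "has_choquet (\<lambda>x. h (tail F x)) (h 1) (S_ab a b F + k * Q_mix c \<alpha> F)"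
      using has_choquet_qsm[OF F p] qsm_distortion_1[OF p] in01 eq by simp
    then show ?thesis by (rule has_choquet_I_h)
  qed
qed

text \<open>A function \<open>v\<close> with three values makes \<open>h\<close> of the tail a step function, so that no
  measurability of \<open>h\<close> is needed.\<close>

lemma three_valued_transformation:
  assumes M: "M \<subseteq> compactly_supported_dists" and h: "h 0 = 0" and xyz: "x < y" "y < z"
    and pts: "return borel x \<in> M" "return borel y \<in> M" "return borel z \<in> M"
  shows "\<exists>v\<in>V_M M. R_real_valued_on M h v"
proof
  let ?v = "\<lambda>u. if u = x then x else if u = y then y else z"
  have v: "?v \<in> borel_measurable borel" by measurable
  then show "?v \<in> V_M M"
    unfolding V_M_def mem_Collect_eq using xyz pts
    by (intro conjI exI[of _ z, THEN exI[of _ y], THEN exI[of _ x]]) auto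
  show "R_real_valued_on M h ?v"
    unfolding R_real_valued_on_def
  proof
    fix F assume "F \<in> M"
    then interpret real_distribution F using M by (auto simp: compactly_supported_dists_def)
    have tail: "tail (distr F borel ?v) u = measure F (?v -` {u<..})" for u
      using v by (simp add: measure_distr_real)
    have "?v -` {u<..} = UNIV" if "u < x" for u using that xyz by auto
    moreover have "?v -` {u<..} = - {x}" if "x \<le> u" "u < y" for u using that xyz by auto
    moreover have "?v -` {u<..} = - {x, y}" if "y \<le> u" "u < z" for u using that xyz by auto
    moreover have "?v -` {u<..} = {}" if "z \<le> u" for u using that xyz by (auto split: if_splits)
    ultimately have "has_choquet (\<lambda>u. h (tail (distr F borel ?v) u)) (h 1)
       (x * h 1 + (y - x) * h (measure F (- {x})) + (z - y) * h (measure F (- {x, y})))"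
      using xyz h prob_space unfolding tail by (intro has_choquet_three_steps) simp_all
    then show "I_finite h (distr F borel ?v)" by (rule has_choquet_I_h)
  qed
qed

theorem theorem2:
  fixes M :: "real measure set" and h :: "real \<Rightarrow> real"
  assumes "M \<subseteq> compactly_supported_dists"
    and "convex_dists M"
    and "\<exists>x y z. distinct [x, y, z] \<and>
           return borel x \<in> M \<and> return borel y \<in> M \<and> return borel z \<in> M"
    and "h \<in> H_BV"
  shows "(h \<in> H_CX \<union> H_QSM \<longleftrightarrow> p_quasi_convex_on M (I_h h)) \<and>
    (p_quasi_convex_on M (I_h h) \<longleftrightarrow>
       (\<exists>v\<in>V_M M. R_real_valued_on M h v \<and> p_quasi_convex_on M (R_hv h v))) \<and>
    ((\<exists>v\<in>V_M M. R_real_valued_on M h v \<and> p_quasi_convex_on M (R_hv h v)) \<longleftrightarrow>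
       (\<forall>v\<in>borel_measurable borel.
          R_real_valued_on M h v \<longrightarrow> p_quasi_convex_on M (R_hv h v)))"
proof -
  note M = assms(1,2) and h = assms(4)
  have id: "(\<lambda>x. x) \<in> V_M M" using assms(3) by (auto simp: V_M_def)
  have sets: "sets F = sets borel" if "F \<in> M" for F
    using that M(1) by (auto simp: compactly_supported_dists_def real_distribution_def real_distribution_axioms_def)
  have "p_quasi_convex_on M (R_hv h (\<lambda>x. x)) \<longleftrightarrow> p_quasi_convex_on M (I_h h)"
    by (auto simp: p_quasi_convex_on_def R_hv_id sets)
  \<comment> \<open>Finiteness for the identity is available once \<open>h\<close> has the required
    shape, which quasi-convexity of \<open>I_h\<close> yields first.\<close>
  moreover have "R_real_valued_on M h (\<lambda>x. x)" if "h \<in> H_CX \<union> H_QSM"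
  proof -
    have "I_finite h (distr F borel (\<lambda>x. x))" if "F \<in> M" for F
      using I_finite_compactly_supported[OF h \<open>h \<in> H_CX \<union> H_QSM\<close>, of F] that M(1) sets[OF that]
      by (auto simp: I_finite_def measure_distr_real)
    then show ?thesis by (simp add: R_real_valued_on_def)
  qed
  \<comment> \<open>Passing from all \<open>v\<close> to some \<open>v\<close> starts without
    knowledge of the shape of \<open>h\<close>, so an admissible \<open>v\<close> is supplied
    independently of it.\<close>
  moreover obtain v where "v \<in> V_M M" "R_real_valued_on M h v"
    using three_valued_transformation[where h = h, OF M(1) H_BV_0[OF h]] assms(3)
      distinct_sorted[of "\<lambda>x. x" _ _ _ "\<lambda>x. return borel x \<in> M"] by blast
  moreover have "V_M M \<subseteq> borel_measurable borel" by (auto simp: V_M_def)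
  ultimately show ?thesis
    using CX_or_QSM_of_p_quasi_convex[OF M h] R_hv_p_quasi_convex[OF M h] id by blast
qed

end
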